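(* Let $(\mathcal{M},g)$ be a compact, connected, smooth, boundaryless Riemannian manifold of dimension $n\ge 2$ with nonnegative Ricci curvature. Let $\Phi\in C^3([0,+\infty))$ with $\Phi(0)=0$, let $F\in C^2(\mathbb{R})$ with $F\ge 0$ and $F''\ge 0$, and assume that either Assumption (A) or Assumption (B) (stated in the context) holds. Let $u\in C^3(\mathcal{M})$ be a solution on $\mathcal{M}$ of $$\mathrm{div}\left(\Phi'(|\nabla u|^2)\nabla u\right)=F'(u).$$ Then $u$ is constant.
   Context: $\nabla$ is the Levi-Civita connection (and gradient) and $\mathrm{div}$ the divergence of $(\mathcal{M},g)$. For $\sigma\in\mathbb{R}^n$ set $a_{ij}(\sigma)=2\Phi''(|\sigma|^2)\sigma_i\sigma_j+\Phi'(|\sigma|^2)\delta_{ij}$. Assumption (A): there exist $p>1$, $a\ge 0$ and $c_1,c_2>0$ such that for all $\sigma,\xi\in\mathbb{R}^n\setminus\{0\}$, $$c_1(a+|\sigma|)^{p-2}\le\Phi'(|\sigma|^2)\le c_2(a+|\sigma|)^{p-2},$$ $$c_1(a+|\sigma|)^{p-2}|\xi|^2\le\sum_{i,j=1}^n a_{ij}(\sigma)\xi_i\xi_j\le c_2(a+|\sigma|)^{p-2}|\xi|^2.$$ Assumption (B): there exist $c_1,c_2>0$ such that for all $\sigma\in\mathbb{R}^n$, $$c_1(1+|\sigma|)^{-1}\le\Phi'(|\sigma|^2)\le c_2(1+|\sigma|)^{-1},$$ $$c_1(1+|\sigma|)^{-1}|\xi'|^2\le\sum_{i,j=1}^n a_{ij}(\sigma)\xi_i\xi_j\le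 c_2(1+|\sigma|)^{-1}|\xi'|^2$$ for every $\xi'=(\xi,\xi_{n+1})\in\mathbb{R}^{n+1}$ orthogonal to $(-\sigma,1)\in\mathbb{R}^{n+1}$. *)

theory Defs
  imports "HOL-Analysis.Analysis"
begin

section \<open>Functions of class \<open>C\<^sup>k\<close>\<close>

text \<open>Intended for sets \<open>S\<close> on which derivatives within \<open>S\<close> are unique: open sets and
  nondegenerate intervals such as \<open>{0..}\<close>, where the derivative at \<open>0\<close> is one-sided.\<close>

primrec C_k_on :: "nat \<Rightarrow> ('a::euclidean_space \<Rightarrow> 'b::real_normed_vector) \<Rightarrow> 'a set \<Rightarrow> bool" where
  "C_k_on 0 f S \<longleftrightarrow> continuous_on S f"
| "C_k_on (Suc k) f S \<longleftrightarrow> f differentiable_on S \<and>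
     (\<forall>b\<in>Basis. C_k_on k (\<lambda>x. frechet_derivative f (at x within S) b) S)"

definition smooth_on :: "('a::euclidean_space \<Rightarrow> 'b::real_normed_vector) \<Rightarrow> 'a set \<Rightarrow> bool" where
  "smooth_on f S \<longleftrightarrow> (\<forall>k. C_k_on k f S)"

definition partial_deriv ::
    "'n::finite \<Rightarrow> (real^'n \<Rightarrow> 'b::real_normed_vector) \<Rightarrow> real^'n \<Rightarrow> 'b" where
  "partial_deriv i f x = frechet_derivative f (at x) (axis i 1)"

text \<open>Derivative of a function on the half line \<open>[0,\<infinity>)\<close>, one-sided at \<open>0\<close>; values of the
  function at negative arguments play no role.\<close>

definition deriv_half_line :: "(real \<Rightarrow> real) \<Rightarrow> real \<Rightarrow> real" where
  "deriv_half_line f t = vector_derivative f (at t within {0..})"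


section \<open>Smooth manifolds and Riemannian metrics\<close>

text \<open>A chart is its domain together with the coordinate map.  The map is total; its values
  outside the domain play no role.\<close>

type_synonym ('a, 'n) chart = "'a set \<times> ('a \<Rightarrow> real^'n)"

definition chart_image :: "('a, 'n::finite) chart \<Rightarrow> (real^'n) set" where
  "chart_image c = snd c ` fst c"

definition chart_inv :: "('a, 'n::finite) chart \<Rightarrow> real^'n \<Rightarrow> 'a" where
  "chart_inv c = inv_into (fst c) (snd c)"

definition transition :: "('a, 'n::finite) chart \<Rightarrow> ('a, 'n) chart \<Rightarrow> real^'n \<Rightarrow> real^'n" where
  "transition c d = snd d \<circ> chart_inv c"

definition is_chart :: "'a topology \<Rightarrow> ('a, 'n::finite) chart \<Rightarrow> bool" where
  "is_chart X c \<longleftrightarrow> openin X (fst c) \<and> open (chart_image c) \<and>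
     homeomorphic_map (subtopology X (fst c)) (top_of_set (chart_image c)) (snd c)"

text \<open>The atlas is not required to be maximal: every smooth atlas determines a smooth structure.\<close>

definition smooth_manifold :: "'a topology \<Rightarrow> ('a, 'n::finite) chart set \<Rightarrow> bool" where
  "smooth_manifold X A \<longleftrightarrow> Hausdorff_space X \<and> second_countable X \<and>
     (\<forall>c\<in>A. is_chart X c) \<and> (\<Union>c\<in>A. fst c) = topspace X \<and>
     (\<forall>c\<in>A. \<forall>d\<in>A. smooth_on (transition c d) (snd c ` (fst c \<inter> fst d)))"

definition C_k_function :: "nat \<Rightarrow> ('a, 'n::finite) chart set \<Rightarrow> ('a \<Rightarrow> real) \<Rightarrow> bool" where
  "C_k_function k A f \<longleftrightarrow> (\<forall>c\<in>A. C_k_on k (f \<circ> chart_inv c) (chart_image c))"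

text \<open>A Riemannian metric is given by its matrix of components \<open>g\<^sub>i\<^sub>j\<close> in each chart, as a
  function of the coordinates; on overlaps the components obey the transformation law of
  a (0,2)-tensor.\<close>

type_synonym 'n metric_comps = "real^'n \<Rightarrow> real^'n^'n"

definition riemannian_metric ::
    "('a, 'n::finite) chart set \<Rightarrow> (('a, 'n) chart \<Rightarrow> 'n metric_comps) \<Rightarrow> bool" where
  "riemannian_metric A g \<longleftrightarrow>
     (\<forall>c\<in>A. smooth_on (g c) (chart_image c) \<and>
        (\<forall>y\<in>chart_image c. transpose (g c y) = g c y \<and>
           (\<forall>v. v \<noteq> 0 \<longrightarrow> v \<bullet> (g c y *v v) > 0))) \<and>
     (\<forall>c\<in>A. \<forall>d\<in>A. \<forall>y \<in> snd c ` (fst c \<inter> fst d).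
        let J = jacobian (transition c d) (at y)
        in g c y = transpose J ** g d (transition c d y) ** J)"


section \<open>Differential operators of a metric, in local coordinates\<close>

text \<open>The Christoffel symbol \<open>\<Gamma>\<^sup>k\<^sub>i\<^sub>j\<close> of the Levi-Civita connection.\<close>

definition christoffel :: "'n::finite metric_comps \<Rightarrow> 'n \<Rightarrow> 'n \<Rightarrow> 'n \<Rightarrow> real^'n \<Rightarrow> real" where
  "christoffel g k i j x = (1/2) * (\<Sum>l\<in>UNIV. matrix_inv (g x) $ k $ l *
     (partial_deriv i (\<lambda>y. g y $ j $ l) x + partial_deriv j (\<lambda>y. g y $ i $ l) x
       - partial_deriv l (\<lambda>y. g y $ i $ j) x))"

text \<open>\<open>\<nabla>\<^sub>i Z\<close>, the Levi-Civita derivative of the vector field \<open>Z\<close> along the coordinate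
  field \<open>\<partial>\<^sub>i\<close>.\<close>

definition cov_deriv ::
    "'n::finite metric_comps \<Rightarrow> 'n \<Rightarrow> (real^'n \<Rightarrow> real^'n) \<Rightarrow> real^'n \<Rightarrow> real^'n" where
  "cov_deriv g i Z x =
     (\<chi> k. partial_deriv i (\<lambda>y. Z y $ k) x + (\<Sum>j\<in>UNIV. christoffel g k i j x * Z x $ j))"

text \<open>\<open>R(\<partial>\<^sub>i,\<partial>\<^sub>j)\<partial>\<^sub>k = \<nabla>\<^sub>i\<nabla>\<^sub>j\<partial>\<^sub>k - \<nabla>\<^sub>j\<nabla>\<^sub>i\<partial>\<^sub>k\<close>; coordinate fields commute.\<close>

definition riemann_curvature ::
    "'n::finite metric_comps \<Rightarrow> 'n \<Rightarrow> 'n \<Rightarrow> 'n \<Rightarrow> real^'n \<Rightarrow> real^'n" where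
  "riemann_curvature g i j k x =
     cov_deriv g i (cov_deriv g j (\<lambda>y. axis k 1)) x
     - cov_deriv g j (cov_deriv g i (\<lambda>y. axis k 1)) x"

text \<open>\<open>Ric(Y,Z)\<close> is the trace of \<open>V \<mapsto> R(V,Y)Z\<close>; round spheres have positive Ricci curvature.\<close>

definition ricci :: "'n::finite metric_comps \<Rightarrow> real^'n \<Rightarrow> real^'n^'n" where
  "ricci g x = (\<chi> j k. \<Sum>i\<in>UNIV. riemann_curvature g i j k x $ i)"

definition nonneg_ricci ::
    "('a, 'n::finite) chart set \<Rightarrow> (('a, 'n) chart \<Rightarrow> 'n metric_comps) \<Rightarrow> bool" where
  "nonneg_ricci A g \<longleftrightarrow>
     (\<forall>c\<in>A. \<forall>y\<in>chart_image c. \<forall>v. v \<bullet> (ricci (g c) y *v v) \<ge> 0)"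

definition gradient :: "'n::finite metric_comps \<Rightarrow> (real^'n \<Rightarrow> real) \<Rightarrow> real^'n \<Rightarrow> real^'n" where
  "gradient g f x = matrix_inv (g x) *v (\<chi> i. partial_deriv i f x)"

definition metric_norm_sq :: "'n::finite metric_comps \<Rightarrow> real^'n \<Rightarrow> real^'n \<Rightarrow> real" where
  "metric_norm_sq g x v = v \<bullet> (g x *v v)"

text \<open>The trace of \<open>\<nabla>Z\<close>.\<close>

definition divergence :: "'n::finite metric_comps \<Rightarrow> (real^'n \<Rightarrow> real^'n) \<Rightarrow> real^'n \<Rightarrow> real" where
  "divergence g Z x = (\<Sum>i\<in>UNIV. cov_deriv g i Z x $ i)"

text \<open>\<open>div (\<Phi>'(|\<nabla>u|\<^sup>2) \<nabla>u) = F'(u)\<close> at every point of the manifold.\<close>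

definition solves_on_manifold ::
    "('a, 'n::finite) chart set \<Rightarrow> (('a, 'n) chart \<Rightarrow> 'n metric_comps) \<Rightarrow>
     (real \<Rightarrow> real) \<Rightarrow> (real \<Rightarrow> real) \<Rightarrow> ('a \<Rightarrow> real) \<Rightarrow> bool" where
  "solves_on_manifold A g \<Phi> F u \<longleftrightarrow>
     (\<forall>c\<in>A. \<forall>y\<in>chart_image c.
        let v = u \<circ> chart_inv c; G = gradient (g c) v
        in divergence (g c)
             (\<lambda>z. deriv_half_line \<Phi> (metric_norm_sq (g c) z (G z)) *\<^sub>R G z) y = deriv F (v y))"


section \<open>Structural assumptions on \<open>\<Phi>\<close>\<close>

definition a_coeff :: "(real \<Rightarrow> real) \<Rightarrow> real^'n::finite \<Rightarrow> 'n \<Rightarrow> 'n \<Rightarrow> real" where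
  "a_coeff \<Phi> \<sigma> i j =
     2 * deriv_half_line (deriv_half_line \<Phi>) ((norm \<sigma>)\<^sup>2) * \<sigma> $ i * \<sigma> $ j
     + deriv_half_line \<Phi> ((norm \<sigma>)\<^sup>2) * (if i = j then 1 else 0)"

text \<open>The type argument carries the dimension \<open>n\<close>.\<close>

definition assumption_A :: "'n::finite itself \<Rightarrow> (real \<Rightarrow> real) \<Rightarrow> bool" where
  "assumption_A _ \<Phi> \<longleftrightarrow>
     (\<exists>p a c1 c2 :: real. p > 1 \<and> a \<ge> 0 \<and> c1 > 0 \<and> c2 > 0 \<and>
       (\<forall>\<sigma> \<xi> :: real^'n. \<sigma> \<noteq> 0 \<longrightarrow> \<xi> \<noteq> 0 \<longrightarrow>
          c1 * (a + norm \<sigma>) powr (p - 2) \<le> deriv_half_line \<Phi> ((norm \<sigma>)\<^sup>2) \<and>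
          deriv_half_line \<Phi> ((norm \<sigma>)\<^sup>2) \<le> c2 * (a + norm \<sigma>) powr (p - 2) \<and>
          c1 * (a + norm \<sigma>) powr (p - 2) * (norm \<xi>)\<^sup>2
            \<le> (\<Sum>i\<in>UNIV. \<Sum>j\<in>UNIV. a_coeff \<Phi> \<sigma> i j * \<xi> $ i * \<xi> $ j) \<and>
          (\<Sum>i\<in>UNIV. \<Sum>j\<in>UNIV. a_coeff \<Phi> \<sigma> i j * \<xi> $ i * \<xi> $ j)
            \<le> c2 * (a + norm \<sigma>) powr (p - 2) * (norm \<xi>)\<^sup>2))"

text \<open>\<open>\<real>\<^sup>n\<^sup>+\<^sup>1\<close> is rendered as \<open>\<real>\<^sup>n \<times> \<real>\<close> with its Euclidean product structure.\<close>

definition assumption_B :: "'n::finite itself \<Rightarrow> (real \<Rightarrow> real) \<Rightarrow> bool" where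
  "assumption_B _ \<Phi> \<longleftrightarrow>
     (\<exists>c1 c2 :: real. c1 > 0 \<and> c2 > 0 \<and>
       (\<forall>\<sigma> :: real^'n.
          c1 * inverse (1 + norm \<sigma>) \<le> deriv_half_line \<Phi> ((norm \<sigma>)\<^sup>2) \<and>
          deriv_half_line \<Phi> ((norm \<sigma>)\<^sup>2) \<le> c2 * inverse (1 + norm \<sigma>) \<and>
          (\<forall>\<xi>' :: (real^'n) \<times> real. orthogonal \<xi>' (- \<sigma>, 1) \<longrightarrow>
             (let \<xi> = fst \<xi>' in
              c1 * inverse (1 + norm \<sigma>) * (norm \<xi>')\<^sup>2
                \<le> (\<Sum>i\<in>UNIV. \<Sum>j\<in>UNIV. a_coeff \<Phi> \<sigma> i j * \<xi> $ i * \<xi> $ j) \<and>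
              (\<Sum>i\<in>UNIV. \<Sum>j\<in>UNIV. a_coeff \<Phi> \<sigma> i j * \<xi> $ i * \<xi> $ j)
                \<le> c2 * inverse (1 + norm \<sigma>) * (norm \<xi>')\<^sup>2))))"

end

theory Submission
  imports Defs
begin

text \<open>
  Write \<open>\<phi>\<close> for the derivative of \<open>\<Phi>\<close>.  The function \<open>u\<close> is constant because it is a subsolution of
  \<open>div (\<phi>(|\<nabla>u|\<^sup>2) \<nabla>u) = 0\<close> that attains its maximum, and this operator satisfies a strong maximum principle.

  That \<open>u\<close> is a subsolution is seen at a point where \<open>u\<close> is minimal.  There the gradient vanishes, the divergence
  reduces to \<open>\<phi> 0\<close> times the Laplacian, and so it is nonnegative (\<open>divergence_nonneg_at_local_min\<close>); the equation gives
  \<open>F' (min u) \<ge> 0\<close>.  As \<open>F'\<close> is nondecreasing, \<open>F' (u) \<ge> 0\<close> everywhere.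

  The operator may degenerate where the gradient vanishes, for instance for the \<open>p\<close>-Laplacian, so the maximum principle
  must avoid such points.  Hopf's barrier does so (\<open>no_interior_touching_point\<close>): if the set where \<open>u\<close> is maximal
  had a boundary point, \<open>u\<close> plus a small multiple of \<open>exp (- \<alpha> |x - y|\<^sup>2)\<close> would have an interior maximum at a point where
  the gradient of the barrier, and hence that of \<open>u\<close>, is nonzero.  At that single point the expansion of the divergence
  into second derivatives and first-order terms (\<open>divergence_expansion\<close>) shows that it is negative for large
  \<open>\<alpha>\<close> (\<open>divergence_neg_at_barrier_contact\<close>), which contradicts \<open>F' (u) \<ge> 0\<close>.  Ellipticity is used in the form
  that the eigenvalues \<open>\<phi>(s)\<close> and \<open>\<phi>(s) + 2 s \<phi>'(s)\<close> of the coefficient matrix are positive and comparable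
  for small \<open>s > 0\<close> (\<open>flux_elliptic\<close>).  Each of the two structural assumptions gives this on testing with \<open>\<xi> = \<sigma>\<close>.

  The set where \<open>u\<close> is maximal is therefore open.  It is also closed and nonempty, and the manifold is connected.
\<close>

section \<open>Positive semidefinite matrices\<close>

lemma quadratic_form_eq_sum:
  fixes H :: "real^'n^'n"
  shows "x \<bullet> (H *v x) = (\<Sum>i\<in>UNIV. \<Sum>j\<in>UNIV. x $ i * x $ j * H $ i $ j)"
  unfolding inner_vec_def matrix_vector_mult_def
  by (simp add: sum_distrib_left mult_ac)

lemma symmetric_matrix_inner_commute:
  fixes B :: "real^'n^'n"
  assumes "transpose B = B"
  shows "x \<bullet> (B *v y) = y \<bullet> (B *v x)"
  by (metis assms dot_lmul_matrix inner_commute transpose_matrix_vector)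

text \<open>Cholesky elimination writes \<open>B\<close> as a sum of terms \<open>b b\<^sup>T / B\<^sub>k\<^sub>k\<close>, each of which contributes a value
  \<open>b \<bullet> H b / B\<^sub>k\<^sub>k \<ge> 0\<close>.  The induction is on a set of indices outside which the rows of \<open>B\<close> vanish.
  Only the quadratic form of \<open>H\<close> enters, and this is what derivatives along lines give.\<close>

lemma trace_mult_nonneg:
  fixes B H :: "real^'n^'n"
  assumes sym: "transpose B = B" and psd: "\<And>x. x \<bullet> (B *v x) \<ge> 0"
    and H: "\<And>x. x \<bullet> (H *v x) \<ge> 0"
  shows "(\<Sum>i\<in>UNIV. \<Sum>j\<in>UNIV. B $ i $ j * H $ i $ j) \<ge> 0"
proof -
  have "(\<Sum>i\<in>UNIV. \<Sum>j\<in>UNIV. B $ i $ j * H $ i $ j) \<ge> 0"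
    if "finite S" "transpose B = B" "\<And>x. x \<bullet> (B *v x) \<ge> 0" "\<And>i j. i \<notin> S \<Longrightarrow> B $ i $ j = 0"
    for S and B :: "real^'n^'n"
    using that
  proof (induction S arbitrary: B rule: finite_induct)
    case empty
    then show ?case by simp
  next
    case (insert k S)
    define b where "b = B *v axis k 1"
    have b: "b $ i = B $ i $ k" for i
      by (simp add: b_def matrix_vector_mult_basis column_def)
    have Bkk: "axis k 1 \<bullet> b = B $ k $ k"
      by (simp add: inner_axis' b)
    have symB: "B $ i $ j = B $ j $ i" for i j
      by (metis insert.prems(1) transpose_def vec_lambda_beta)
    have shift: "x \<bullet> (B *v x) - 2 * t * (b \<bullet> x) + t\<^sup>2 * B $ k $ k \<ge> 0" for x t
    proof -
      have "x \<bullet> b = axis k 1 \<bullet> (B *v x)"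
        unfolding b_def by (rule symmetric_matrix_inner_commute[OF insert.prems(1)])
      then have "(x - t *\<^sub>R axis k 1) \<bullet> (B *v (x - t *\<^sub>R axis k 1))
          = x \<bullet> (B *v x) - 2 * t * (b \<bullet> x) + t\<^sup>2 * B $ k $ k"
        by (simp add: matrix_vector_mult_diff_distrib matrix_vector_mult_scaleR inner_diff_left inner_diff_right
            b_def[symmetric] Bkk inner_commute[of b] power2_eq_square algebra_simps)
      then show ?thesis
        using insert.prems(2)[of "x - t *\<^sub>R axis k 1"] by simp
    qed
    show ?case
    proof (cases "B $ k $ k = 0")
      case True
      have "b = 0"
      proof (rule ccontr)
        assume "b \<noteq> 0"
        then have bb: "b \<bullet> b > 0" by simp
        \<comment> \<open>This \<open>t\<close> is the one for which \<open>shift\<close> would read \<open>- 1 \<ge> 0\<close>.\<close>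
        show False
          using shift[of b "(b \<bullet> (B *v b) + 1) / (2 * (b \<bullet> b))"] bb True by simp
      qed
      then have "B $ i $ k = 0" for i
        using b[of i] by simp
      then have "B $ i $ j = 0" if "i \<notin> S" for i j
        using insert.prems(3)[of i j] that symB[of k j] by (cases "i = k") auto
      then show ?thesis
        using insert.IH[of B] insert.prems by blast
    next
      case False
      then have pos: "B $ k $ k > 0"
        using insert.prems(2)[of "axis k 1"] Bkk unfolding b_def by simp
      define C :: "real^'n^'n" where "C = (\<chi> i j. B $ i $ j - b $ i * b $ j / B $ k $ k)"
      have "transpose C = C"
        by (simp add: C_def transpose_def vec_eq_iff symB mult.commute)
      moreover have "x \<bullet> (C *v x) \<ge> 0" for x
      proof -
        have "C *v x = B *v x - ((b \<bullet> x) / B $ k $ k) *\<^sub>R b"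
          by (simp add: C_def vec_eq_iff matrix_vector_mult_def inner_vec_def left_diff_distrib
              right_diff_distrib sum_subtractf sum_distrib_left sum_divide_distrib sum_distrib_right mult_ac)
        then have "x \<bullet> (C *v x) = x \<bullet> (B *v x) - (b \<bullet> x)\<^sup>2 / B $ k $ k"
          by (simp add: inner_diff_right inner_commute[of x b] power2_eq_square)
        also have "\<dots> = x \<bullet> (B *v x) - 2 * ((b \<bullet> x) / B $ k $ k) * (b \<bullet> x)
            + ((b \<bullet> x) / B $ k $ k)\<^sup>2 * B $ k $ k"
          using pos by (simp add: power2_eq_square field_simps)
        finally show ?thesis
          using shift[of x "(b \<bullet> x) / B $ k $ k"] by simp
      qed
      moreover have "C $ i $ j = 0" if "i \<notin> S" for i j
      proof (cases "i = k")
        case True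
        then show ?thesis
          using pos symB[of k j] by (simp add: C_def b)
      next
        case False
        then show ?thesis
          using that insert.prems(3) by (simp add: C_def b)
      qed
      ultimately have "(\<Sum>i\<in>UNIV. \<Sum>j\<in>UNIV. C $ i $ j * H $ i $ j) \<ge> 0"
        using insert.IH[of C] by blast
      moreover have "(\<Sum>i\<in>UNIV. \<Sum>j\<in>UNIV. B $ i $ j * H $ i $ j)
          = (\<Sum>i\<in>UNIV. \<Sum>j\<in>UNIV. C $ i $ j * H $ i $ j) + (b \<bullet> (H *v b)) / B $ k $ k"
        unfolding quadratic_form_eq_sum
        by (simp add: C_def left_diff_distrib sum_subtractf sum_divide_distrib)
      ultimately show ?thesis
        using H[of b] pos by simp
    qed
  qed
  from this[of UNIV B] show ?thesis
    using sym psd by simp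
qed

lemma psd_cauchy_schwarz:
  fixes B :: "real^'n^'n"
  assumes "transpose B = B" and "\<And>x. x \<bullet> (B *v x) \<ge> 0" and "x \<bullet> (B *v x) > 0"
  shows "(x \<bullet> (B *v y))\<^sup>2 \<le> (x \<bullet> (B *v x)) * (y \<bullet> (B *v y))"
proof -
  define t where "t = (x \<bullet> (B *v y)) / (x \<bullet> (B *v x))"
  have "y \<bullet> (B *v x) = x \<bullet> (B *v y)"
    by (rule symmetric_matrix_inner_commute[OF assms(1)])
  then have "(y - t *\<^sub>R x) \<bullet> (B *v (y - t *\<^sub>R x))
      = y \<bullet> (B *v y) - 2 * t * (x \<bullet> (B *v y)) + t * t * (x \<bullet> (B *v x))"
    by (simp add: matrix_vector_mult_diff_distrib matrix_vector_mult_scaleR inner_diff_left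
        inner_diff_right algebra_simps)
  also have "\<dots> = y \<bullet> (B *v y) - (x \<bullet> (B *v y))\<^sup>2 / (x \<bullet> (B *v x))"
    using assms(3) by (simp add: t_def power2_eq_square field_simps)
  finally show ?thesis
    using assms(2)[of "y - t *\<^sub>R x"] assms(3)
    by (simp only: diff_ge_0_iff_ge pos_divide_le_eq mult.commute)
qed

lemma posdef_invertible:
  fixes A :: "real^'n^'n"
  assumes "\<And>v. v \<noteq> 0 \<Longrightarrow> v \<bullet> (A *v v) > 0"
  shows "invertible A"
proof -
  have "x = 0" if "A *v x = 0" for x
    using assms[of x] that by force
  then show ?thesis
    using matrix_left_invertible_ker[of A] invertible_left_inverse by metis
qed

lemma matrix_inv_mult:
  fixes A :: "real^'n^'n"
  assumes "invertible A"
  shows "A ** matrix_inv A = mat 1" "matrix_inv A ** A = mat 1"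
  using someI_ex[of "\<lambda>B. A ** B = mat 1 \<and> B ** A = mat 1"] assms
  unfolding invertible_def matrix_inv_def by auto

text \<open>Cramer's rule, applied to the columns of the identity.  It shows that the entries of the
  inverse of a differentiable metric are differentiable.\<close>

lemma matrix_inv_nth_eq_det:
  fixes A :: "real^'n^'n"
  assumes "invertible A"
  shows "matrix_inv A $ i $ j =
    det (\<chi> a b. if b = i then (if a = j then 1 else 0) else A $ a $ b) / det A"
proof -
  have "A *v (matrix_inv A *v axis j 1) = axis j 1"
    using matrix_inv_mult[OF assms] by (simp add: matrix_vector_mul_assoc)
  then have "(matrix_inv A *v axis j 1) $ i =
    det (\<chi> a b. if b = i then axis j 1 $ a else A $ a $ b) / det A"
    using cramer[of A "matrix_inv A *v axis j 1" "axis j 1"] assms invertible_det_nz[of A]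
    by (metis (no_types, lifting) vec_lambda_beta)
  moreover have "(matrix_inv A *v axis j 1) $ i = matrix_inv A $ i $ j"
    by (simp add: matrix_vector_mult_basis column_def)
  ultimately show ?thesis
    by (simp add: axis_def cong: if_cong)
qed

section \<open>Partial derivatives and second-order conditions\<close>

lemma partial_deriv_eq:
  assumes "(f has_derivative f') (at x)"
  shows "partial_deriv i f x = f' (axis i 1)"
  unfolding partial_deriv_def using frechet_derivative_at[OF assms] by simp

lemma has_derivative_frechet:
  assumes "f differentiable (at x)"
  shows "(f has_derivative frechet_derivative f (at x)) (at x)"
  using assms frechet_derivative_works by blast

lemma partial_deriv_mult:
  fixes f h :: "real^'n \<Rightarrow> real"
  assumes "f differentiable (at x)" "h differentiable (at x)"
  shows "partial_deriv i (\<lambda>y. f y * h y) x = f x * partial_deriv i h x + partial_deriv i f x * h x"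
  using partial_deriv_eq[OF has_derivative_mult[OF assms[THEN has_derivative_frechet]]]
  by (simp add: partial_deriv_def)

lemma partial_deriv_sum:
  fixes f :: "'j \<Rightarrow> real^'n \<Rightarrow> real"
  assumes "finite J" "\<And>j. j \<in> J \<Longrightarrow> f j differentiable (at x)"
  shows "partial_deriv i (\<lambda>y. \<Sum>j\<in>J. f j y) x = (\<Sum>j\<in>J. partial_deriv i (f j) x)"
proof -
  have "((\<lambda>y. \<Sum>j\<in>J. f j y) has_derivative (\<lambda>w. \<Sum>j\<in>J. frechet_derivative (f j) (at x) w)) (at x)"
    by (intro has_derivative_sum has_derivative_frechet assms)
  from partial_deriv_eq[OF this] show ?thesis
    by (simp add: partial_deriv_def)
qed

lemma partial_deriv_cong:
  assumes "open S" "x \<in> S" "\<And>y. y \<in> S \<Longrightarrow> f y = h y" "f differentiable (at x)"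
  shows "partial_deriv i f x = partial_deriv i h x"
  unfolding partial_deriv_def
  using frechet_derivative_transform_within_open[OF assms(4,1,2)] assms(3) by simp

lemma differentiable_cong_open:
  assumes "f differentiable (at x)" "open S" "x \<in> S" "\<And>y. y \<in> S \<Longrightarrow> f y = h y"
  shows "h differentiable (at x)"
  using assms unfolding differentiable_def
  by (metis has_derivative_transform_within_open)

lemma differentiable_vec_nth:
  assumes "f differentiable (at x)"
  shows "(\<lambda>y. f y $ i) differentiable (at x)"
  using assms unfolding differentiable_def
  using bounded_linear.has_derivative[OF bounded_linear_vec_nth] by blast

lemma partial_deriv_vec_nth:
  assumes "f differentiable (at x)"
  shows "partial_deriv k (\<lambda>y. f y $ i) x = partial_deriv k f x $ i"
  using partial_deriv_eq[OF bounded_linear.has_derivative[OF bounded_linear_vec_nth has_derivative_frechet[OF assms]]]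
  by (simp add: partial_deriv_def)

lemma differentiable_prod:
  fixes f :: "'j \<Rightarrow> 'a::real_normed_vector \<Rightarrow> real"
  assumes "finite J" "\<And>j. j \<in> J \<Longrightarrow> f j differentiable (at x)"
  shows "(\<lambda>y. \<Prod>j\<in>J. f j y) differentiable (at x)"
  using assms by (induction J rule: finite_induct) auto

lemma differentiable_det:
  fixes M :: "'a::real_normed_vector \<Rightarrow> real^'n^'n"
  assumes "\<And>i j. (\<lambda>y. M y $ i $ j) differentiable (at x)"
  shows "(\<lambda>y. det (M y)) differentiable (at x)"
  unfolding det_def
  by (intro differentiable_sum ballI differentiable_mult differentiable_prod assms differentiable_const)
     (auto intro: finite_permutations)

lemma continuous_on_matrix_vector_mult:
  fixes M :: "real^'n \<Rightarrow> real^'n^'n"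
  assumes "continuous_on T M" "continuous_on T \<eta>"
  shows "continuous_on T (\<lambda>x. M x *v \<eta> x)"
  unfolding matrix_vector_mult_def
  using assms by (intro continuous_on_vec_lambda continuous_intros)

lemma C_k_on_imp_differentiable:
  assumes "open S" "C_k_on (Suc k) f S" "x \<in> S"
  shows "f differentiable (at x)"
proof -
  have "f differentiable (at x within S)"
    using assms by (simp add: differentiable_on_def)
  then show ?thesis
    using at_within_open[OF assms(3,1)] by simp
qed

lemma C_k_on_imp_continuous_partial_deriv:
  assumes "open S" "C_k_on (Suc 0) f S"
  shows "continuous_on S (partial_deriv i f)"
proof -
  have "continuous_on S (\<lambda>x. frechet_derivative f (at x within S) (axis i 1))"
    using assms(2) by simp
  moreover have "frechet_derivative f (at x within S) (axis i 1) = partial_deriv i f x" if "x \<in> S" for x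
    using at_within_open[OF that assms(1)] by (simp add: partial_deriv_def)
  ultimately show ?thesis
    by (rule continuous_on_eq)
qed

lemma C_k_on_imp_differentiable_partial_deriv:
  assumes "open S" "C_k_on (Suc (Suc k)) f S" "x \<in> S"
  shows "partial_deriv i f differentiable (at x)"
proof -
  have "C_k_on (Suc k) (\<lambda>x. frechet_derivative f (at x within S) (axis i 1)) S"
    using assms(2) by simp
  then have "(\<lambda>x. frechet_derivative f (at x within S) (axis i 1)) differentiable (at x)"
    using assms C_k_on_imp_differentiable by blast
  then show ?thesis
    by (rule differentiable_cong_open[OF _ assms(1,3)])
      (simp add: partial_deriv_def at_within_open[OF _ assms(1)])
qed

text \<open>If \<open>c\<close> were negative, then \<open>h'\<close> would be negative immediately to the right of \<open>0\<close>, and \<open>h\<close> would fall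
  below \<open>h 0\<close> there by the mean value theorem.\<close>

lemma local_min_second_derivative_nonneg:
  fixes h h' :: "real \<Rightarrow> real"
  assumes "d > 0" and h: "\<And>t. \<bar>t\<bar> < d \<Longrightarrow> (h has_real_derivative h' t) (at t)"
    and h': "(h' has_real_derivative c) (at 0)"
    and min: "\<And>t. \<bar>t\<bar> < d \<Longrightarrow> h 0 \<le> h t"
  shows "c \<ge> 0"
proof (rule ccontr)
  assume "\<not> c \<ge> 0"
  have h0: "h' 0 = 0"
    using DERIV_local_min[OF h[of 0] \<open>d > 0\<close>] min \<open>d > 0\<close> by simp
  from DERIV_neg_dec_right[OF h'] \<open>\<not> c \<ge> 0\<close> obtain e
    where e: "e > 0" "\<And>t. 0 < t \<Longrightarrow> t < e \<Longrightarrow> h' t < 0"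
    using h0 by auto
  define s where "s = min d e / 2"
  have s: "0 < s" "s < d" "s < e"
    using e(1) \<open>d > 0\<close> by (auto simp: s_def min_def)
  have "\<exists>z>0. z < s \<and> h s - h 0 = (s - 0) * h' z"
    using s h by (intro MVT2) auto
  then obtain z where z: "0 < z" "z < s" "h s - h 0 = s * h' z"
    by auto
  then have "h s < h 0"
    using e(2)[of z] s by (smt (verit) mult_pos_neg)
  then show False
    using min[of s] s by simp
qed

definition second_partials :: "(real^'n::finite \<Rightarrow> real) \<Rightarrow> real^'n \<Rightarrow> real^'n^'n" where
  "second_partials v x = (\<chi> i j. partial_deriv j (partial_deriv i v) x)"

lemma line_derivative:
  fixes f :: "real^'n \<Rightarrow> real"
  assumes "f differentiable (at (z + t *\<^sub>R w))"
  shows "((\<lambda>t. f (z + t *\<^sub>R w)) has_real_derivative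
    (\<Sum>i\<in>UNIV. w $ i * partial_deriv i f (z + t *\<^sub>R w))) (at t)"
proof -
  let ?f' = "frechet_derivative f (at (z + t *\<^sub>R w))"
  have lin: "linear ?f'"
    using has_derivative_frechet[OF assms] has_derivative_linear by blast
  have "?f' w = ?f' (\<Sum>i\<in>UNIV. w $ i *\<^sub>R axis i 1)"
    using basis_expansion[of w] by (simp add: scalar_mult_eq_scaleR)
  also have "\<dots> = (\<Sum>i\<in>UNIV. w $ i * partial_deriv i f (z + t *\<^sub>R w))"
    by (simp add: linear_sum[OF lin] linear_scale[OF lin] partial_deriv_def)
  finally have w: "?f' (s *\<^sub>R w) = (\<Sum>i\<in>UNIV. w $ i * partial_deriv i f (z + t *\<^sub>R w)) * s" for s
    by (simp add: linear_scale[OF lin] mult.commute)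
  have "((\<lambda>t. z + t *\<^sub>R w) has_derivative (\<lambda>s. s *\<^sub>R w)) (at t)"
    by (auto intro!: derivative_eq_intros)
  from has_derivative_compose[OF this has_derivative_frechet[OF assms]]
  show ?thesis
    unfolding has_field_derivative_def w .
qed

lemma line_second_derivative:
  fixes v :: "real^'n \<Rightarrow> real"
  assumes "\<And>i. partial_deriv i v differentiable (at z)"
  shows "((\<lambda>t. \<Sum>i\<in>UNIV. w $ i * partial_deriv i v (z + t *\<^sub>R w)) has_real_derivative
    w \<bullet> (second_partials v z *v w)) (at 0)"
proof -
  have "((\<lambda>t. partial_deriv i v (z + t *\<^sub>R w)) has_real_derivative
      (\<Sum>j\<in>UNIV. w $ j * partial_deriv j (partial_deriv i v) z)) (at 0)" for i
    using line_derivative[of "partial_deriv i v" z 0 w] assms by simp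
  then have "((\<lambda>t. \<Sum>i\<in>UNIV. w $ i * partial_deriv i v (z + t *\<^sub>R w)) has_real_derivative
      (\<Sum>i\<in>UNIV. w $ i * (\<Sum>j\<in>UNIV. w $ j * partial_deriv j (partial_deriv i v) z))) (at 0)"
    by (intro DERIV_sum DERIV_cmult)
  then show ?thesis
    unfolding quadratic_form_eq_sum second_partials_def
    by (simp add: sum_distrib_left mult.assoc)
qed

lemma ball_contains_short_segment:
  fixes z :: "'a::real_normed_vector"
  assumes "r > 0"
  obtains d where "d > 0" "\<And>t. \<bar>t\<bar> < d \<Longrightarrow> z + t *\<^sub>R w \<in> ball z r"
proof
  show "r / (norm w + 1) > 0" using assms by (simp add: add_nonneg_pos)
  fix t assume "\<bar>t\<bar> < r / (norm w + 1)"
  then have "\<bar>t\<bar> * (norm w + 1) < r"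
    by (simp add: pos_less_divide_eq add_nonneg_pos)
  then have "\<bar>t\<bar> * norm w < r"
    by (smt (verit) mult_left_mono)
  then show "z + t *\<^sub>R w \<in> ball z r"
    by (simp add: dist_norm)
qed

text \<open>First- and second-order conditions at an interior maximum \<open>z\<close> of \<open>v\<close> plus a multiple of the Hopf barrier
  \<open>exp (- \<alpha> |x - y|\<^sup>2)\<close>, read off along each line \<open>t \<mapsto> z + t w\<close>.  The barrier has gradient
  \<open>- 2\<alpha> (z - y)\<close> times its value, and this is the origin of \<open>\<tau>\<close>: the gradient of \<open>v\<close> has to
  cancel that of the barrier.\<close>

lemma critical_point_of_barrier_sum:
  fixes v :: "real^'n \<Rightarrow> real"
  assumes "r > 0" and v: "\<And>x. x \<in> ball z r \<Longrightarrow> v differentiable (at x)"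
    and dv: "\<And>i. partial_deriv i v differentiable (at z)"
    and max: "\<And>x. x \<in> ball z r \<Longrightarrow>
      v x + \<epsilon> * exp (- \<alpha> * (norm (x - y))\<^sup>2) \<le> v z + \<epsilon> * exp (- \<alpha> * (norm (z - y))\<^sup>2)"
  defines "\<tau> \<equiv> 2 * \<alpha> * \<epsilon> * exp (- \<alpha> * (norm (z - y))\<^sup>2)"
  shows "(\<chi> i. partial_deriv i v z) = \<tau> *\<^sub>R (z - y)"
    and "w \<bullet> (second_partials v z *v w) \<le> \<tau> * (w \<bullet> w - 2 * \<alpha> * ((z - y) \<bullet> w)\<^sup>2)"
proof -
  define E where "E = (\<lambda>w t. exp (- \<alpha> * ((z - y) \<bullet> (z - y) + 2 * t * ((z - y) \<bullet> w) + t\<^sup>2 * (w \<bullet> w))))"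
  have nE: "exp (- \<alpha> * (norm (z + t *\<^sub>R w - y))\<^sup>2) = E w t" for w t
  proof -
    have "(a + t *\<^sub>R w) \<bullet> (a + t *\<^sub>R w) = a \<bullet> a + 2 * t * (a \<bullet> w) + t\<^sup>2 * (w \<bullet> w)" for a
      by (simp add: inner_add_left inner_add_right inner_commute[of w a] power2_eq_square algebra_simps)
    moreover have "z + t *\<^sub>R w - y = (z - y) + t *\<^sub>R w" by simp
    ultimately show ?thesis
      unfolding E_def power2_norm_eq_inner by metis
  qed
  define f where "f = (\<lambda>w t. - (v (z + t *\<^sub>R w) + \<epsilon> * E w t))"
  define e where "e = (\<lambda>w t. (- \<alpha>) * (2 * ((z - y) \<bullet> w) + 2 * t * (w \<bullet> w)) * E w t)"
  define f' where "f' = (\<lambda>w t. - ((\<Sum>i\<in>UNIV. w $ i * partial_deriv i v (z + t *\<^sub>R w)) + \<epsilon> * e w t))"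
  have E': "(E w has_real_derivative e w t) (at t)" for w t
    unfolding E_def e_def by (auto intro!: derivative_eq_intros)
  have \<tau>: "\<tau> = 2 * \<alpha> * \<epsilon> * E w 0" for w
    unfolding \<tau>_def E_def by (simp add: power2_norm_eq_inner)
  have e': "((\<lambda>t. e w t) has_real_derivative
      (- \<alpha>) * (2 * (w \<bullet> w)) * E w 0 + (- \<alpha>) * (2 * ((z - y) \<bullet> w)) * e w 0) (at 0)" for w
  proof -
    have "((\<lambda>t. (- \<alpha>) * (2 * ((z - y) \<bullet> w) + 2 * t * (w \<bullet> w))) has_real_derivative
        (- \<alpha>) * (2 * (w \<bullet> w))) (at 0)"
      by (auto intro!: derivative_eq_intros)
    from DERIV_mult[OF this E'[of w 0]] show ?thesis
      by (simp add: e_def[abs_def] mult.commute)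
  qed
  have along: "f' w 0 = 0 \<and> 0 \<le> - (w \<bullet> (second_partials v z *v w) + \<epsilon> * ((- \<alpha>) * (2 * (w \<bullet> w)) * E w 0 +
      (- \<alpha>) * (2 * ((z - y) \<bullet> w)) * e w 0))" for w
  proof -
    obtain d where d: "d > 0" "\<And>t. \<bar>t\<bar> < d \<Longrightarrow> z + t *\<^sub>R w \<in> ball z r"
      using ball_contains_short_segment[OF \<open>r > 0\<close>] by metis
    have f: "(f w has_real_derivative f' w t) (at t)" if "\<bar>t\<bar> < d" for t
      unfolding f_def f'_def
      by (intro DERIV_minus DERIV_add DERIV_cmult line_derivative v d that E')
    have fmin: "f w 0 \<le> f w t" if "\<bar>t\<bar> < d" for t
      using max[OF d(2)[OF that]] nE[of 0 w] nE[of t w] by (simp add: f_def)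
    have "f' w 0 = 0"
      using DERIV_local_min[OF f[of 0] d(1)] fmin d(1) by simp
    moreover have "(f' w has_real_derivative - (w \<bullet> (second_partials v z *v w) +
        \<epsilon> * ((- \<alpha>) * (2 * (w \<bullet> w)) * E w 0 + (- \<alpha>) * (2 * ((z - y) \<bullet> w)) * e w 0))) (at 0)"
      unfolding f'_def
      by (intro DERIV_minus DERIV_add DERIV_cmult line_second_derivative dv e')
    ultimately show ?thesis
      using local_min_second_derivative_nonneg[OF d(1) f _ fmin] by blast
  qed
  show "(\<chi> i. partial_deriv i v z) = \<tau> *\<^sub>R (z - y)"
  proof -
    have "partial_deriv k v z = \<tau> * (z - y) $ k" for k
    proof -
      have "(\<Sum>i\<in>UNIV. axis k 1 $ i * partial_deriv i v z) = partial_deriv k v z"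
        by (simp add: axis_def if_distrib[of "\<lambda>c. c * _"] cong: if_cong)
      moreover have "(z - y) \<bullet> axis k 1 = (z - y) $ k"
        by (simp add: inner_axis)
      ultimately have "\<epsilon> * (\<alpha> * (2 * (z - y) $ k) * E (axis k 1) 0) = partial_deriv k v z"
        using along[of "axis k 1", THEN conjunct1] by (simp add: f'_def e_def)
      then show ?thesis
        by (simp add: \<tau>[of "axis k 1"] algebra_simps)
    qed
    then show ?thesis by (simp add: vec_eq_iff)
  qed
  show "w \<bullet> (second_partials v z *v w) \<le> \<tau> * (w \<bullet> w - 2 * \<alpha> * ((z - y) \<bullet> w)\<^sup>2)"
    using along[of w] by (simp add: e_def \<tau>[of w] power2_eq_square algebra_simps)
qed

section \<open>The quasilinear operator in coordinates\<close>

text \<open>The derivative in direction \<open>k\<close> of \<open>matrix_inv (h x) *v p\<close> for a constant covector \<open>p\<close>, expressed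
  through the vector \<open>\<eta> = matrix_inv (h x) *v p\<close> by differentiating \<open>h x *v \<eta> = p\<close>.\<close>

definition raised_index_deriv :: "'n::finite metric_comps \<Rightarrow> 'n \<Rightarrow> real^'n \<Rightarrow> real^'n \<Rightarrow> real^'n" where
  "raised_index_deriv h k x \<eta> = - (matrix_inv (h x) *v (partial_deriv k h x *v \<eta>))"

text \<open>With \<open>\<eta>\<close> the gradient of a function, the part of its Laplace-Beltrami operator that is of first order.\<close>

definition divergence_drift :: "'n::finite metric_comps \<Rightarrow> real^'n \<Rightarrow> real^'n \<Rightarrow> real" where
  "divergence_drift h x \<eta> = (\<Sum>k\<in>UNIV. raised_index_deriv h k x \<eta> $ k)
     + (\<Sum>k\<in>UNIV. \<Sum>j\<in>UNIV. christoffel h k k j x * \<eta> $ j)"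

text \<open>With \<open>\<eta>\<close> the gradient of a function and \<open>p\<close> its differential, the part of \<open>\<eta>(|\<eta>|\<^sup>2)\<close>, the derivative of
  \<open>|\<eta>|\<^sup>2\<close> along \<open>\<eta>\<close>, that contains no second derivatives.\<close>

definition energy_drift :: "'n::finite metric_comps \<Rightarrow> real^'n \<Rightarrow> real^'n \<Rightarrow> real^'n \<Rightarrow> real" where
  "energy_drift h x p \<eta> = (\<Sum>k\<in>UNIV. \<eta> $ k * (p \<bullet> raised_index_deriv h k x \<eta>))"

text \<open>A Riemannian metric of class \<open>C\<^sup>1\<close> on a coordinate domain.  The maximum principle is local and is proved here,
  for the coordinate expression of the operator.\<close>

locale local_metric =
  fixes S :: "(real^'n) set" and h :: "'n::finite metric_comps"
  assumes open_S: "open S"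
    and h_diff: "\<And>x. x \<in> S \<Longrightarrow> h differentiable (at x)"
    and h_deriv_cont: "\<And>k. continuous_on S (partial_deriv k h)"
    and h_sym: "\<And>x. x \<in> S \<Longrightarrow> transpose (h x) = h x"
    and h_pos: "\<And>x v. x \<in> S \<Longrightarrow> v \<noteq> 0 \<Longrightarrow> v \<bullet> (h x *v v) > 0"
begin

lemma invertible_h: "x \<in> S \<Longrightarrow> invertible (h x)"
  using h_pos by (intro posdef_invertible)

lemma h_inv: "x \<in> S \<Longrightarrow> h x *v (matrix_inv (h x) *v w) = w"
  "x \<in> S \<Longrightarrow> matrix_inv (h x) *v (h x *v w) = w"
  using matrix_inv_mult[OF invertible_h] by (simp_all add: matrix_vector_mul_assoc)

lemma inv_sym:
  assumes "x \<in> S"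
  shows "transpose (matrix_inv (h x)) = matrix_inv (h x)"
proof -
  have "transpose (matrix_inv (h x)) ** (h x ** matrix_inv (h x))
      = transpose (h x ** matrix_inv (h x)) ** matrix_inv (h x)"
    using assms by (simp add: matrix_transpose_mul matrix_mul_assoc h_sym)
  then show ?thesis
    using matrix_inv_mult[OF invertible_h[OF assms]] by (simp add: transpose_mat)
qed

lemma inv_entry_sym:
  assumes "x \<in> S"
  shows "matrix_inv (h x) $ i $ j = matrix_inv (h x) $ j $ i"
  using arg_cong[OF inv_sym[OF assms], of "\<lambda>B. B $ j $ i"] by (simp add: transpose_def)

lemma inv_pos:
  assumes "x \<in> S" "w \<noteq> 0"
  shows "w \<bullet> (matrix_inv (h x) *v w) > 0"
proof -
  have "matrix_inv (h x) *v w \<noteq> 0"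
    using h_inv(1)[OF assms(1), of w] assms(2) by force
  then show ?thesis
    using h_pos[OF assms(1), of "matrix_inv (h x) *v w"] h_inv(1)[OF assms(1), of w] by (simp add: inner_commute)
qed

lemma inv_diff:
  assumes "x \<in> S"
  shows "(\<lambda>y. matrix_inv (h y) $ i $ j) differentiable (at x)"
proof -
  have entry: "(\<lambda>y. h y $ a $ b) differentiable (at x)" for a b
    using h_diff[OF assms] by (intro differentiable_vec_nth)
  have "(\<lambda>y. det (\<chi> a b. if b = i then (if a = j then 1 else 0) else h y $ a $ b) / det (h y))
      differentiable (at x)"
  proof (intro differentiable_divide differentiable_det)
    show "(\<lambda>y. (\<chi> a b. if b = i then (if a = j then 1 else 0) else h y $ a $ b) $ a $ b)
        differentiable (at x)" for a b
      using entry by (cases "b = i") auto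
    show "det (h x) \<noteq> 0"
      using invertible_h[OF assms] invertible_det_nz by blast
  qed (rule entry)
  then show ?thesis
    by (rule differentiable_cong_open[OF _ open_S assms])
      (simp add: matrix_inv_nth_eq_det invertible_h)
qed

lemma inv_cont: "continuous_on S (\<lambda>x. matrix_inv (h x))"
proof -
  have "continuous_on S (\<lambda>y. matrix_inv (h y) $ i $ j)" for i j
    using inv_diff differentiable_imp_continuous_within
    by (metis continuous_at_imp_continuous_on)
  then have "continuous_on S (\<lambda>y. \<chi> i j. matrix_inv (h y) $ i $ j)"
    by (intro continuous_on_vec_lambda)
  then show ?thesis by (simp add: vec_lambda_eta)
qed

lemma partial_deriv_metric_entry:
  assumes "x \<in> S"
  shows "partial_deriv k (\<lambda>y. h y $ a $ b) x = partial_deriv k h x $ a $ b"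
  using partial_deriv_vec_nth[OF differentiable_vec_nth[OF h_diff[OF assms]], of k a b]
    partial_deriv_vec_nth[OF h_diff[OF assms], of k a] by simp

lemma gradient_diff:
  assumes "x \<in> S" and "\<And>i. partial_deriv i v differentiable (at x)"
  shows "(\<lambda>y. gradient h v y $ k) differentiable (at x)"
  unfolding gradient_def matrix_vector_mult_def vec_lambda_beta
  using assms inv_diff[OF assms(1)] by (intro differentiable_sum ballI differentiable_mult) auto

lemma metric_gradient: "x \<in> S \<Longrightarrow> h x *v gradient h v x = (\<chi> i. partial_deriv i v x)"
  by (simp add: gradient_def h_inv)

lemma metric_norm_sq_gradient:
  "x \<in> S \<Longrightarrow> metric_norm_sq h x (gradient h v x) = (\<Sum>i\<in>UNIV. partial_deriv i v x * gradient h v x $ i)"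
  by (simp add: metric_norm_sq_def metric_gradient inner_vec_def mult.commute)

text \<open>The identity \<open>h *v gradient h v = dv\<close> is differentiated and solved for the derivative of the gradient.\<close>

lemma partial_deriv_gradient:
  assumes x: "x \<in> S" and v: "\<And>i. partial_deriv i v differentiable (at x)"
  shows "(\<chi> i. partial_deriv k (\<lambda>y. gradient h v y $ i) x)
    = matrix_inv (h x) *v column k (second_partials v x) + raised_index_deriv h k x (gradient h v x)"
proof -
  define dG where "dG = (\<chi> i. partial_deriv k (\<lambda>y. gradient h v y $ i) x)"
  have entry: "(\<lambda>y. h y $ a $ b) differentiable (at x)" for a b
    using h_diff[OF x] by (intro differentiable_vec_nth)
  have "partial_deriv k (\<lambda>y. \<Sum>l\<in>UNIV. h y $ j $ l * gradient h v y $ l) x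
      = (h x *v dG + partial_deriv k h x *v gradient h v x) $ j" for j
    by (subst partial_deriv_sum)
      (auto simp: partial_deriv_mult entry gradient_diff[OF x v] partial_deriv_metric_entry[OF x] dG_def matrix_vector_mult_def sum.distrib)
  moreover have "partial_deriv k (\<lambda>y. \<Sum>l\<in>UNIV. h y $ j $ l * gradient h v y $ l) x
      = column k (second_partials v x) $ j" for j
  proof -
    have "(\<Sum>l\<in>UNIV. h y $ j $ l * gradient h v y $ l) = partial_deriv j v y" if "y \<in> S" for y
      using metric_gradient[OF that, of v] by (simp add: matrix_vector_mult_def vec_eq_iff)
    then show ?thesis
      by (subst partial_deriv_cong[OF open_S x, of _ "partial_deriv j v"])
        (auto simp: column_def second_partials_def entry gradient_diff[OF x v])
  qed
  ultimately have "h x *v dG + partial_deriv k h x *v gradient h v x = column k (second_partials v x)"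
    by (simp add: vec_eq_iff)
  then have "matrix_inv (h x) *v (h x *v dG)
      = matrix_inv (h x) *v (column k (second_partials v x) - partial_deriv k h x *v gradient h v x)"
    by (metis add_diff_cancel_right')
  then show ?thesis
    unfolding raised_index_deriv_def dG_def[symmetric]
    by (simp add: h_inv(2)[OF x] matrix_vector_mult_diff_distrib)
qed

text \<open>The product rule for \<open>\<phi>(|\<nabla>v|\<^sup>2) \<nabla>v\<close> separates the second derivatives of \<open>v\<close>, which enter through the
  matrix \<open>\<phi> matrix_inv h + 2 \<phi>' G G\<^sup>T\<close>, from terms of first order.  The derivative of \<open>|\<nabla>v|\<^sup>2\<close> contains each
  second derivative twice, once through \<open>dv\<close> and once through \<open>G\<close>, whence the factor \<open>2\<close>.\<close>

lemma divergence_expansion: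
  fixes \<phi> :: "real \<Rightarrow> real" and v :: "real^'n \<Rightarrow> real"
  assumes x: "x \<in> S" and v: "\<And>y i. y \<in> S \<Longrightarrow> partial_deriv i v differentiable (at y)"
    and \<phi>: "\<And>s. s \<ge> 0 \<Longrightarrow> (\<phi> has_real_derivative \<phi>' s) (at s within {0..})"
  defines "G \<equiv> gradient h v" and "p \<equiv> (\<chi> i. partial_deriv i v x)" and "H \<equiv> second_partials v x"
  defines "q \<equiv> metric_norm_sq h x (G x)"
  shows "divergence h (\<lambda>z. \<phi> (metric_norm_sq h z (G z)) *\<^sub>R G z) x
    = \<phi>' q * (2 * (G x \<bullet> (H *v G x)) + energy_drift h x p (G x))
      + \<phi> q * ((\<Sum>i\<in>UNIV. \<Sum>j\<in>UNIV. matrix_inv (h x) $ i $ j * H $ i $ j) + divergence_drift h x (G x))"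
proof -
  define Q where "Q = (\<lambda>z. metric_norm_sq h z (G z))"
  define D where "D = (\<lambda>k. raised_index_deriv h k x (G x))"
  have Gd: "(\<lambda>y. G y $ k) differentiable (at x)" for k
    unfolding G_def using gradient_diff[OF x v[OF x]] .
  have dG: "partial_deriv k (\<lambda>y. G y $ i) x = (matrix_inv (h x) *v column k H) $ i + D k $ i" for k i
    using arg_cong[OF partial_deriv_gradient[OF x v[OF x], of k], of "\<lambda>w. w $ i"]
    unfolding G_def H_def D_def by simp
  have Qeq: "Q y = (\<Sum>i\<in>UNIV. partial_deriv i v y * G y $ i)" if "y \<in> S" for y
    using metric_norm_sq_gradient[OF that] by (simp add: Q_def G_def)
  have Sd: "(\<lambda>y. \<Sum>i\<in>UNIV. partial_deriv i v y * G y $ i) differentiable (at x)"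
    using v[OF x] Gd by (intro differentiable_sum ballI differentiable_mult) auto
  have Qd: "Q differentiable (at x)"
    using differentiable_cong_open[OF Sd open_S x, of Q] Qeq by simp
  have GH: "p \<bullet> (matrix_inv (h x) *v w) = G x \<bullet> w" for w
    using symmetric_matrix_inner_commute[OF inv_sym[OF x], of p w]
    by (simp add: G_def gradient_def p_def inner_commute)
  have dQ: "partial_deriv k Q x = 2 * (G x \<bullet> column k H) + p \<bullet> D k" for k
  proof -
    have "partial_deriv k Q x = partial_deriv k (\<lambda>y. \<Sum>i\<in>UNIV. partial_deriv i v y * G y $ i) x"
      by (rule partial_deriv_cong[OF open_S x Qeq Qd])
    also have "\<dots> = (\<Sum>i\<in>UNIV. partial_deriv i v x * partial_deriv k (\<lambda>y. G y $ i) x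
        + partial_deriv k (partial_deriv i v) x * G x $ i)"
      using v[OF x] Gd by (subst partial_deriv_sum) (auto simp: partial_deriv_mult)
    also have "\<dots> = p \<bullet> (matrix_inv (h x) *v column k H + D k) + G x \<bullet> column k H"
      by (simp add: dG sum.distrib p_def H_def inner_vec_def second_partials_def column_def mult.commute)
    finally show ?thesis
      by (simp add: inner_add_right GH)
  qed
  have Qnn: "Q y \<ge> 0" if "y \<in> S" for y
    using h_pos[OF that, of "G y"] unfolding Q_def metric_norm_sq_def
    by (cases "G y = 0") (auto simp: less_imp_le)
  have phiQ: "((\<lambda>y. \<phi> (Q y)) has_derivative (\<lambda>w. \<phi>' q * frechet_derivative Q (at x) w)) (at x)"
  proof -
    have Q': "(Q has_derivative frechet_derivative Q (at x)) (at x within S)"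
      using has_derivative_frechet[OF Qd] has_derivative_at_withinI by blast
    have "(\<phi> has_derivative (*) (\<phi>' q)) (at (Q x) within Q ` S)"
      using \<phi>[OF Qnn[OF x]] has_derivative_subset[of \<phi> "(*) (\<phi>' q)" "Q x" "{0..}" "Q ` S"] Qnn
      unfolding has_field_derivative_def Q_def q_def by blast
    from has_derivative_in_compose[OF Q' this] show ?thesis
      using at_within_open[OF x open_S] by simp
  qed
  have Zd: "partial_deriv k (\<lambda>y. \<phi> (Q y) * G y $ k) x
      = \<phi> q * ((matrix_inv (h x) *v column k H) $ k + D k $ k)
        + \<phi>' q * (2 * (G x \<bullet> column k H) + p \<bullet> D k) * G x $ k" for k
  proof -
    have "(\<lambda>y. \<phi> (Q y)) differentiable (at x)"
      using phiQ unfolding differentiable_def by blast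
    moreover have "partial_deriv k (\<lambda>y. \<phi> (Q y)) x = \<phi>' q * partial_deriv k Q x"
      using partial_deriv_eq[OF phiQ] by (simp add: partial_deriv_def)
    ultimately show ?thesis
      by (simp add: partial_deriv_mult Gd dG dQ) (simp add: Q_def q_def)
  qed
  have tr: "(\<Sum>k\<in>UNIV. (matrix_inv (h x) *v column k H) $ k)
      = (\<Sum>i\<in>UNIV. \<Sum>j\<in>UNIV. matrix_inv (h x) $ i $ j * H $ i $ j)"
  proof -
    have "(\<Sum>k\<in>UNIV. (matrix_inv (h x) *v column k H) $ k)
        = (\<Sum>k\<in>UNIV. \<Sum>j\<in>UNIV. matrix_inv (h x) $ j $ k * H $ j $ k)"
      by (simp add: matrix_vector_mult_def column_def inv_entry_sym[OF x])
    also have "\<dots> = (\<Sum>i\<in>UNIV. \<Sum>j\<in>UNIV. matrix_inv (h x) $ i $ j * H $ i $ j)"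
      by (rule sum.swap)
    finally show ?thesis .
  qed
  have hess: "(\<Sum>k\<in>UNIV. (G x \<bullet> column k H) * G x $ k) = G x \<bullet> (H *v G x)"
  proof -
    have "(\<Sum>k\<in>UNIV. (G x \<bullet> column k H) * G x $ k)
        = (\<Sum>k\<in>UNIV. \<Sum>i\<in>UNIV. G x $ i * G x $ k * H $ i $ k)"
      by (simp add: inner_vec_def column_def sum_distrib_left sum_distrib_right mult_ac)
    also have "\<dots> = G x \<bullet> (H *v G x)"
      unfolding quadratic_form_eq_sum by (rule sum.swap)
    finally show ?thesis .
  qed
  have "divergence h (\<lambda>z. \<phi> (metric_norm_sq h z (G z)) *\<^sub>R G z) x
      = (\<Sum>k\<in>UNIV. partial_deriv k (\<lambda>y. \<phi> (Q y) * G y $ k) x)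
        + (\<Sum>k\<in>UNIV. \<Sum>j\<in>UNIV. christoffel h k k j x * (\<phi> q * G x $ j))"
    by (simp add: divergence_def cov_deriv_def sum.distrib Q_def q_def)
  also have "\<dots> = \<phi> q * (\<Sum>k\<in>UNIV. (matrix_inv (h x) *v column k H) $ k)
        + \<phi> q * (\<Sum>k\<in>UNIV. D k $ k)
        + \<phi>' q * (2 * (\<Sum>k\<in>UNIV. (G x \<bullet> column k H) * G x $ k) + (\<Sum>k\<in>UNIV. G x $ k * (p \<bullet> D k)))
        + \<phi> q * (\<Sum>k\<in>UNIV. \<Sum>j\<in>UNIV. christoffel h k k j x * G x $ j)"
    unfolding Zd by (simp add: sum.distrib sum_distrib_left algebra_simps)
  finally show ?thesis
    unfolding tr hess energy_drift_def divergence_drift_def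
    by (simp add: D_def algebra_simps)
qed

end

text \<open>The homogeneity of the first-order terms lets the size \<open>\<tau>\<close> of the gradient of the barrier be divided out,
  so that the estimates below are uniform in the amplitude of the barrier.\<close>

lemma raised_index_deriv_scaleR:
  "raised_index_deriv h k x (c *\<^sub>R \<eta>) = c *\<^sub>R raised_index_deriv h k x \<eta>"
  by (simp add: raised_index_deriv_def matrix_vector_mult_scaleR)

lemma divergence_drift_scaleR: "divergence_drift h x (c *\<^sub>R \<eta>) = c * divergence_drift h x \<eta>"
  by (simp add: divergence_drift_def raised_index_deriv_scaleR sum_distrib_left algebra_simps)

lemma energy_drift_scaleR: "energy_drift h x (c *\<^sub>R p) (c *\<^sub>R \<eta>) = c ^ 3 * energy_drift h x p \<eta>"
  by (simp add: energy_drift_def raised_index_deriv_scaleR sum_distrib_left power3_eq_cube algebra_simps)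

section \<open>The strong maximum principle\<close>

text \<open>For \<open>|\<sigma>|\<^sup>2 = s\<close>, the matrix \<open>a_coeff \<Phi> \<sigma>\<close> has the eigenvalue \<open>\<phi> s\<close> on the orthogonal complement of \<open>\<sigma>\<close>
  and the eigenvalue \<open>\<phi> s + 2 s \<phi>' s\<close> on \<open>\<sigma>\<close>, where \<open>\<phi>\<close> is the derivative of \<open>\<Phi>\<close>.  They are required to be
  positive and comparable for small \<open>s > 0\<close>; both may tend to \<open>0\<close> as \<open>s\<close> does.\<close>

definition flux_elliptic :: "(real \<Rightarrow> real) \<Rightarrow> (real \<Rightarrow> real) \<Rightarrow> real \<Rightarrow> bool" where
  "flux_elliptic \<phi> \<phi>' K \<longleftrightarrow> K \<ge> 1 \<and> (\<forall>s. 0 < s \<longrightarrow> s \<le> 1 \<longrightarrow>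
     \<phi> s > 0 \<and> \<phi> s \<le> K * (\<phi> s + 2 * s * \<phi>' s) \<and> \<phi> s + 2 * s * \<phi>' s \<le> K * \<phi> s)"

lemma compact_continuous_abs_bound:
  fixes f :: "'a::topological_space \<Rightarrow> real"
  assumes "compact D" "continuous_on D f"
  obtains C where "\<And>x. x \<in> D \<Longrightarrow> \<bar>f x\<bar> \<le> C"
proof -
  have "bounded (f ` D)"
    using assms compact_continuous_image compact_imp_bounded by blast
  then show ?thesis
    using that unfolding bounded_iff by auto
qed

context local_metric
begin

lemma inv_nth_cont: "continuous_on S (\<lambda>x. matrix_inv (h x) $ i $ j)"
  by (intro continuous_on_component inv_cont)

lemma raised_index_deriv_cont:
  "continuous_on S \<eta> \<Longrightarrow> continuous_on S (\<lambda>x. raised_index_deriv h k x (\<eta> x))"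
  unfolding raised_index_deriv_def
  by (intro continuous_on_minus continuous_on_matrix_vector_mult inv_cont h_deriv_cont)

lemma christoffel_cont: "continuous_on S (christoffel h k i j)"
proof -
  have "christoffel h k i j x = (1/2) * (\<Sum>l\<in>UNIV. matrix_inv (h x) $ k $ l *
     (partial_deriv i h x $ j $ l + partial_deriv j h x $ i $ l - partial_deriv l h x $ i $ j))"
    if "x \<in> S" for x
    using that by (simp add: christoffel_def partial_deriv_metric_entry)
  moreover have "continuous_on S (\<lambda>x. (1/2) * (\<Sum>l\<in>UNIV. matrix_inv (h x) $ k $ l *
     (partial_deriv i h x $ j $ l + partial_deriv j h x $ i $ l - partial_deriv l h x $ i $ j)))"
    by (intro continuous_intros inv_nth_cont continuous_on_component h_deriv_cont)
  ultimately show ?thesis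
    using continuous_on_eq by (metis (no_types, lifting))
qed

lemma divergence_drift_cont:
  assumes "continuous_on S \<eta>"
  shows "continuous_on S (\<lambda>x. divergence_drift h x (\<eta> x))"
  unfolding divergence_drift_def
  by (intro continuous_intros christoffel_cont raised_index_deriv_cont assms)

lemma energy_drift_cont:
  assumes "continuous_on S \<eta>" "continuous_on S p"
  shows "continuous_on S (\<lambda>x. energy_drift h x (p x) (\<eta> x))"
  unfolding energy_drift_def
  by (intro continuous_intros raised_index_deriv_cont assms)

text \<open>The computation behind the Hopf barrier.  The matrix \<open>B\<close> of the principal part is positive
  semidefinite by ellipticity, and the second derivatives of \<open>v\<close> are at most \<open>\<tau> (I - 2\<alpha> \<xi> \<xi>\<^sup>T)\<close>, so the trace inequality
  bounds the divergence by \<open>\<tau>\<close> times a quantity in which only the term \<open>- 2\<alpha> Q (\<phi> + 2 q \<phi>')\<close>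
  contains \<open>\<alpha>\<close>.  All other terms are at most a constant times \<open>\<phi>\<close>, and \<open>\<phi>\<close> and \<open>\<phi> + 2 q \<phi>'\<close>
  are comparable, so a large \<open>\<alpha>\<close> makes the total negative.\<close>

lemma divergence_neg_at_barrier_contact:
  fixes \<phi> \<phi>' :: "real \<Rightarrow> real" and v :: "real^'n \<Rightarrow> real" and \<xi> :: "real^'n"
  assumes x: "x \<in> S" and v: "\<And>y i. y \<in> S \<Longrightarrow> partial_deriv i v differentiable (at y)"
    and \<phi>: "\<And>s. s \<ge> 0 \<Longrightarrow> (\<phi> has_real_derivative \<phi>' s) (at s within {0..})"
    and ell: "flux_elliptic \<phi> \<phi>' K"
    and "\<xi> \<noteq> 0" "\<tau> > 0"
    and p: "(\<chi> i. partial_deriv i v x) = \<tau> *\<^sub>R \<xi>"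
    and H: "\<And>w. w \<bullet> (second_partials v x *v w) \<le> \<tau> * (w \<bullet> w - 2 * \<alpha> * (\<xi> \<bullet> w)\<^sup>2)"
  defines "\<eta> \<equiv> matrix_inv (h x) *v \<xi>"
  defines "Q \<equiv> \<xi> \<bullet> \<eta>"
  assumes small: "\<tau>\<^sup>2 * Q \<le> 1"
    and C1: "\<bar>(\<eta> \<bullet> \<eta> + energy_drift h x \<xi> \<eta> / 2) / Q\<bar> \<le> C"
    and C2: "\<bar>(\<Sum>i\<in>UNIV. matrix_inv (h x) $ i $ i) + divergence_drift h x \<eta>\<bar> \<le> C"
    and \<alpha>: "K * (K + 1) * C < 2 * \<alpha> * Q"
  shows "divergence h (\<lambda>z. \<phi> (metric_norm_sq h z (gradient h v z)) *\<^sub>R gradient h v z) x < 0"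
proof -
  define q where "q = \<tau>\<^sup>2 * Q"
  \<comment> \<open>\<open>f\<close> and \<open>f + D1\<close> are the two eigenvalues that ellipticity compares.\<close>
  define D1 where "D1 = 2 * q * \<phi>' q"
  define f where "f = \<phi> q"
  define E1 where "E1 = (\<eta> \<bullet> \<eta> + energy_drift h x \<xi> \<eta> / 2) / Q"
  define E2 where "E2 = (\<Sum>i\<in>UNIV. matrix_inv (h x) $ i $ i) + divergence_drift h x \<eta>"
  have Q: "Q > 0"
    unfolding Q_def \<eta>_def using inv_pos[OF x \<open>\<xi> \<noteq> 0\<close>] .
  then have q: "q > 0" "q \<le> 1"
    using \<open>\<tau> > 0\<close> small by (auto simp: q_def)
  have G: "gradient h v x = \<tau> *\<^sub>R \<eta>"
    unfolding gradient_def p \<eta>_def by (simp add: matrix_vector_mult_scaleR)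
  have mq: "metric_norm_sq h x (gradient h v x) = q"
    unfolding metric_norm_sq_def metric_gradient[OF x] p
    unfolding G q_def Q_def
    by (simp add: power2_eq_square inner_commute)
  have K: "K \<ge> 1" and f: "f > 0" "f \<le> K * (f + D1)" "f + D1 \<le> K * f"
    using ell q unfolding flux_elliptic_def f_def D1_def by auto
  have fD: "f + D1 > 0"
    using f K by (smt (verit) mult_nonneg_nonpos)
  define B :: "real^'n^'n" where
    "B = (\<chi> i j. f * matrix_inv (h x) $ i $ j + 2 * \<phi>' q * \<tau>\<^sup>2 * \<eta> $ i * \<eta> $ j)"
  have Bsym: "transpose B = B"
    by (simp add: B_def transpose_def vec_eq_iff inv_entry_sym[OF x])
  have Bw: "B *v w = f *\<^sub>R (matrix_inv (h x) *v w) + (2 * \<phi>' q * \<tau>\<^sup>2 * (\<eta> \<bullet> w)) *\<^sub>R \<eta>" for w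
    by (simp add: B_def vec_eq_iff matrix_vector_mult_def inner_vec_def distrib_right distrib_left sum.distrib
        sum_distrib_left sum_distrib_right mult_ac)
  have Bpos: "w \<bullet> (B *v w) \<ge> 0" for w
  proof -
    define W where "W = w \<bullet> (matrix_inv (h x) *v w)"
    have inv_nonneg: "u \<bullet> (matrix_inv (h x) *v u) \<ge> 0" for u
      using inv_pos[OF x, of u] by (cases "u = 0") auto
    have W: "W \<ge> 0"
      unfolding W_def by (rule inv_nonneg)
    \<comment> \<open>Cauchy-Schwarz bounds the rank-one term by \<open>q\<close> times the inverse metric, so that a negative \<open>\<phi>' q\<close> still leaves the factor \<open>f + D1\<close>.\<close>
    have "\<eta> \<bullet> w = \<xi> \<bullet> (matrix_inv (h x) *v w)"
      unfolding \<eta>_def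
      using symmetric_matrix_inner_commute[OF inv_sym[OF x], of w \<xi>] by (simp add: inner_commute)
    then have CS: "(\<eta> \<bullet> w)\<^sup>2 \<le> Q * W"
      using psd_cauchy_schwarz[OF inv_sym[OF x] inv_nonneg, of \<xi> w] Q
      unfolding Q_def \<eta>_def W_def by simp
    have eq: "w \<bullet> (B *v w) = f * W + 2 * \<phi>' q * (\<tau>\<^sup>2 * (\<eta> \<bullet> w)\<^sup>2)"
      by (simp add: Bw W_def inner_add_right inner_commute[of w \<eta>] power2_eq_square)
    show ?thesis
    proof (cases "\<phi>' q \<ge> 0")
      case True
      then show ?thesis using eq f(1) W by simp
    next
      case False
      have "\<tau>\<^sup>2 * (\<eta> \<bullet> w)\<^sup>2 \<le> q * W"
        using mult_left_mono[OF CS, of "\<tau>\<^sup>2"] by (simp add: q_def mult.assoc)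
      then have "2 * \<phi>' q * (\<tau>\<^sup>2 * (\<eta> \<bullet> w)\<^sup>2) \<ge> 2 * \<phi>' q * (q * W)"
        using False by (intro mult_left_mono_neg) auto
      then have "w \<bullet> (B *v w) \<ge> (f + D1) * W"
        unfolding eq D1_def by (simp add: algebra_simps)
      then show ?thesis
        using fD W by (smt (verit) mult_nonneg_nonneg)
    qed
  qed
  define N :: "real^'n^'n" where "N = (\<chi> i j. \<tau> * ((if i = j then 1 else 0) - 2 * \<alpha> * \<xi> $ i * \<xi> $ j)
    - second_partials v x $ i $ j)"
  have Nw: "N *v w = \<tau> *\<^sub>R (w - (2 * \<alpha> * (\<xi> \<bullet> w)) *\<^sub>R \<xi>) - second_partials v x *v w" for w
    by (simp add: N_def vec_eq_iff matrix_vector_mult_def inner_vec_def left_diff_distrib right_diff_distrib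
        sum_subtractf sum_distrib_left sum_distrib_right mult_ac if_distrib[of "\<lambda>c. c * _"]
        if_distrib[of "\<lambda>c. _ * c"] cong: if_cong)
  have "w \<bullet> (N *v w) \<ge> 0" for w
    using H[of w] by (simp add: Nw inner_diff_right inner_commute[of w \<xi>] power2_eq_square algebra_simps)
  then have "(\<Sum>i\<in>UNIV. \<Sum>j\<in>UNIV. B $ i $ j * N $ i $ j) \<ge> 0"
    by (intro trace_mult_nonneg Bsym Bpos)
  moreover have "(\<Sum>i\<in>UNIV. \<Sum>j\<in>UNIV. B $ i $ j * N $ i $ j)
      = \<tau> * (\<Sum>i\<in>UNIV. B $ i $ i) - 2 * \<tau> * \<alpha> * (\<xi> \<bullet> (B *v \<xi>))
        - (\<Sum>i\<in>UNIV. \<Sum>j\<in>UNIV. B $ i $ j * second_partials v x $ i $ j)"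
    unfolding N_def quadratic_form_eq_sum[of \<xi> B]
    by (simp add: right_diff_distrib left_diff_distrib sum_subtractf sum_distrib_left mult_ac
        if_distrib[of "\<lambda>c. _ * c"] cong: if_cong)
  moreover have "(\<Sum>i\<in>UNIV. B $ i $ i) = f * (\<Sum>i\<in>UNIV. matrix_inv (h x) $ i $ i) + 2 * \<phi>' q * \<tau>\<^sup>2 * (\<eta> \<bullet> \<eta>)"
    by (simp add: B_def sum.distrib sum_distrib_left inner_vec_def mult_ac)
  moreover have "\<xi> \<bullet> (B *v \<xi>) = f * Q + 2 * \<phi>' q * \<tau>\<^sup>2 * Q\<^sup>2"
    by (simp add: Bw Q_def \<eta>_def inner_add_right inner_commute[of \<xi>] power2_eq_square)
  moreover have "(\<Sum>i\<in>UNIV. \<Sum>j\<in>UNIV. B $ i $ j * second_partials v x $ i $ j)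
      = f * (\<Sum>i\<in>UNIV. \<Sum>j\<in>UNIV. matrix_inv (h x) $ i $ j * second_partials v x $ i $ j)
        + 2 * \<phi>' q * \<tau>\<^sup>2 * (\<eta> \<bullet> (second_partials v x *v \<eta>))"
    unfolding quadratic_form_eq_sum[of \<eta>]
    by (simp add: B_def distrib_right distrib_left sum.distrib sum_distrib_left mult_ac)
  ultimately have ineq: "f * (\<Sum>i\<in>UNIV. \<Sum>j\<in>UNIV. matrix_inv (h x) $ i $ j * second_partials v x $ i $ j)
        + 2 * \<phi>' q * \<tau>\<^sup>2 * (\<eta> \<bullet> (second_partials v x *v \<eta>))
      \<le> \<tau> * (f * (\<Sum>i\<in>UNIV. matrix_inv (h x) $ i $ i) + 2 * \<phi>' q * \<tau>\<^sup>2 * (\<eta> \<bullet> \<eta>))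
        - 2 * \<tau> * \<alpha> * (f * Q + 2 * \<phi>' q * \<tau>\<^sup>2 * Q\<^sup>2)"
    by (simp only: diff_ge_0_iff_ge)
  have "divergence h (\<lambda>z. \<phi> (metric_norm_sq h z (gradient h v z)) *\<^sub>R gradient h v z) x
      = f * (\<Sum>i\<in>UNIV. \<Sum>j\<in>UNIV. matrix_inv (h x) $ i $ j * second_partials v x $ i $ j)
        + 2 * \<phi>' q * \<tau>\<^sup>2 * (\<eta> \<bullet> (second_partials v x *v \<eta>))
        + \<phi>' q * \<tau> ^ 3 * energy_drift h x \<xi> \<eta> + f * \<tau> * divergence_drift h x \<eta>"
    using divergence_expansion[where \<phi> = \<phi> and \<phi>' = \<phi>' and v = v, OF x v \<phi>]
    unfolding mq p
    unfolding G energy_drift_scaleR divergence_drift_scaleR f_def[symmetric]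
    by (simp add: matrix_vector_mult_scaleR power2_eq_square algebra_simps)
  also have "\<dots> \<le> \<tau> * (f * (\<Sum>i\<in>UNIV. matrix_inv (h x) $ i $ i) + 2 * \<phi>' q * \<tau>\<^sup>2 * (\<eta> \<bullet> \<eta>))
        - 2 * \<tau> * \<alpha> * (f * Q + 2 * \<phi>' q * \<tau>\<^sup>2 * Q\<^sup>2)
        + \<phi>' q * \<tau> ^ 3 * energy_drift h x \<xi> \<eta> + f * \<tau> * divergence_drift h x \<eta>"
    using ineq by linarith
  also have "\<dots> = \<tau> * (D1 * E1 + f * E2 - 2 * \<alpha> * Q * (f + D1))"
  proof -
    have "D1 * E1 = 2 * \<phi>' q * \<tau>\<^sup>2 * (\<eta> \<bullet> \<eta> + energy_drift h x \<xi> \<eta> / 2)"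
      using Q by (simp add: D1_def E1_def q_def)
    then show ?thesis
      by (simp add: E2_def D1_def q_def power2_eq_square power3_eq_cube algebra_simps)
  qed
  also have "\<dots> < 0"
  proof -
    have C: "C \<ge> 0" using C1 by linarith
    have "\<bar>D1\<bar> \<le> K * f"
      using f fD K by (smt (verit) mult_le_cancel_right1)
    then have "\<bar>D1\<bar> * \<bar>E1\<bar> \<le> K * f * C"
      using C1 f(1) K unfolding E1_def[symmetric] by (intro mult_mono) auto
    then have a: "D1 * E1 \<le> K * f * C"
      using abs_ge_self[of "D1 * E1"] by (simp add: abs_mult)
    have b: "f * E2 \<le> f * C"
      using C2 f(1) unfolding E2_def[symmetric] by (intro mult_left_mono) auto
    have "K * (K + 1) * C * (f + D1) < 2 * \<alpha> * Q * (f + D1)"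
      using \<alpha> fD by (intro mult_strict_right_mono)
    moreover have "(K + 1) * C * f \<le> (K + 1) * C * (K * (f + D1))"
      using f(2) C K by (intro mult_left_mono) auto
    ultimately have "D1 * E1 + f * E2 - 2 * \<alpha> * Q * (f + D1) < 0"
      using a b by (simp add: algebra_simps)
    then show ?thesis
      using \<open>\<tau> > 0\<close> by (simp add: mult_pos_neg)
  qed
  finally show ?thesis .
qed

text \<open>Suppose that the level \<open>M\<close> is touched on the closed ball about \<open>y\<close> only at the boundary point \<open>x0\<close>.
  In a small ball \<open>D\<close> about \<open>x0\<close>, add to \<open>v\<close> a small multiple of \<open>exp (- \<alpha> |x - y|\<^sup>2)\<close>.
  On the part of the boundary of \<open>D\<close> inside the ball about \<open>y\<close> there is room since \<open>v < M\<close>; on the rest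
  the barrier is smaller than at \<open>x0\<close>.  Hence the maximum over \<open>D\<close> is an interior one.  There the gradient of \<open>v\<close> is
  nonzero, so that the operator is elliptic even if it degenerates at critical points of \<open>v\<close>,
  and the divergence is negative.\<close>

lemma no_interior_touching_point:
  fixes \<phi> \<phi>' :: "real \<Rightarrow> real" and v :: "real^'n \<Rightarrow> real"
  assumes vd: "\<And>x. x \<in> S \<Longrightarrow> v differentiable (at x)"
    and v: "\<And>x i. x \<in> S \<Longrightarrow> partial_deriv i v differentiable (at x)"
    and \<phi>: "\<And>s. s \<ge> 0 \<Longrightarrow> (\<phi> has_real_derivative \<phi>' s) (at s within {0..})"
    and ell: "flux_elliptic \<phi> \<phi>' K"
    and sub: "\<And>x. x \<in> S \<Longrightarrow>
      divergence h (\<lambda>z. \<phi> (metric_norm_sq h z (gradient h v z)) *\<^sub>R gradient h v z) x \<ge> 0"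
    and le: "\<And>x. x \<in> S \<Longrightarrow> v x \<le> M"
    and "R > 0" and x0: "x0 \<in> S" "dist y x0 = R" "v x0 = M"
    and touch: "\<And>x. x \<in> S \<Longrightarrow> x \<in> cball y R \<Longrightarrow> x \<noteq> x0 \<Longrightarrow> v x < M"
  shows False
proof -
  obtain r0 where r0: "r0 > 0" "cball x0 r0 \<subseteq> S"
    using open_contains_cball open_S x0(1) by metis
  \<comment> \<open>The bound \<open>R / 2\<close> keeps the centre \<open>y\<close>, the critical point of the barrier, out of \<open>D\<close>.\<close>
  define r where "r = min r0 (R / 2)"
  define D where "D = cball x0 r"
  have r: "r > 0" "r < R" and DS: "D \<subseteq> S"
    using r0 \<open>R > 0\<close> by (auto simp: r_def D_def)
  have cD: "compact D"
    unfolding D_def by (rule compact_cball)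
  have ne: "x - y \<noteq> 0" if "x \<in> D" for x
    using that r x0(2) by (auto simp: D_def dist_commute)
  define \<eta> where "\<eta> = (\<lambda>x. matrix_inv (h x) *v (x - y))"
  define Q where "Q = (\<lambda>x. (x - y) \<bullet> \<eta> x)"
  define E1 where "E1 = (\<lambda>x. (\<eta> x \<bullet> \<eta> x + energy_drift h x (x - y) (\<eta> x) / 2) / Q x)"
  define E2 where "E2 = (\<lambda>x. (\<Sum>i\<in>UNIV. matrix_inv (h x) $ i $ i) + divergence_drift h x (\<eta> x))"
  have Qpos: "Q x > 0" if "x \<in> D" for x
    unfolding Q_def \<eta>_def using inv_pos[OF _ ne[OF that]] that DS by blast
  have Qne: "Q x \<noteq> 0" if "x \<in> D" for x
    using Qpos[OF that] by simp
  have \<eta>c: "continuous_on S \<eta>"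
    unfolding \<eta>_def by (intro continuous_on_matrix_vector_mult inv_cont continuous_intros)
  have Qc: "continuous_on D Q"
    unfolding Q_def by (intro continuous_intros continuous_on_subset[OF \<eta>c DS])
  have E1c: "continuous_on D E1"
    unfolding E1_def
    by (intro continuous_intros continuous_on_subset[OF energy_drift_cont[OF \<eta>c] DS]
        continuous_on_subset[OF \<eta>c DS] Qc) (simp_all add: Qne)
  have E2c: "continuous_on D E2"
    unfolding E2_def
    by (intro continuous_intros continuous_on_subset[OF divergence_drift_cont[OF \<eta>c] DS]
        continuous_on_subset[OF inv_nth_cont DS])
  obtain C1 where C1: "\<And>x. x \<in> D \<Longrightarrow> \<bar>E1 x\<bar> \<le> C1"
    using compact_continuous_abs_bound[OF cD E1c] by metis
  obtain C2 where C2: "\<And>x. x \<in> D \<Longrightarrow> \<bar>E2 x\<bar> \<le> C2"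
    using compact_continuous_abs_bound[OF cD E2c] by metis
  obtain C3 where C3: "\<And>x. x \<in> D \<Longrightarrow> \<bar>Q x\<bar> \<le> C3"
    using compact_continuous_abs_bound[OF cD Qc] by metis
  have x0D: "x0 \<in> D" using r by (simp add: D_def)
  obtain xm where xm: "xm \<in> D" "\<And>x. x \<in> D \<Longrightarrow> Q xm \<le> Q x"
    using continuous_attains_inf[OF cD _ Qc] x0D by blast
  define m where "m = Q xm"
  have m: "m > 0" "\<And>x. x \<in> D \<Longrightarrow> m \<le> Q x"
    using xm Qpos by (auto simp: m_def)
  have K: "K \<ge> 1" using ell by (simp add: flux_elliptic_def)
  define C where "C = max C1 C2"
  have C0: "C \<ge> 0" using C1[OF x0D] by (auto simp: C_def)
  \<comment> \<open>\<open>\<alpha>\<close> is fixed first and depends on \<open>D\<close> and the operator; the amplitude \<open>\<epsilon>\<close> follows.\<close>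
  define \<alpha> where "\<alpha> = (K * (K + 1) * C + 1) / m"
  have KC: "K * (K + 1) * C \<ge> 0" using K C0 by simp
  then have \<alpha>: "\<alpha> > 0" "K * (K + 1) * C < 2 * \<alpha> * m"
  proof -
    show "\<alpha> > 0" using m(1) KC unfolding \<alpha>_def by (intro divide_pos_pos) linarith+
    have "\<alpha> * m = K * (K + 1) * C + 1" using m(1) by (simp add: \<alpha>_def)
    then show "K * (K + 1) * C < 2 * \<alpha> * m" using KC by linarith
  qed
  define K1 where "K1 = sphere x0 r \<inter> cball y R"
  have vc: "continuous_on S v"
    using vd differentiable_imp_continuous_within continuous_at_imp_continuous_on by blast
  obtain \<delta> where \<delta>: "\<delta> > 0" "\<And>x. x \<in> K1 \<Longrightarrow> v x \<le> M - \<delta>"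
  proof (cases "K1 = {}")
    case True
    then show ?thesis using that[of 1] by simp
  next
    case False
    have K1D: "K1 \<subseteq> D" by (auto simp: K1_def D_def)
    have "compact K1" unfolding K1_def by (intro compact_Int compact_sphere compact_cball)
    moreover have "continuous_on K1 v" using vc K1D DS continuous_on_subset by blast
    ultimately obtain k where k: "k \<in> K1" "\<And>x. x \<in> K1 \<Longrightarrow> v x \<le> v k"
      using continuous_attains_sup[of K1 v] False by blast
    have "v k < M"
      using k(1) K1D DS r by (intro touch) (auto simp: K1_def)
    then show ?thesis using that[of "M - v k"] k by simp
  qed
  \<comment> \<open>The first bound preserves the room on \<open>K1\<close>, the second keeps \<open>|\<nabla>v|\<^sup>2\<close> in the range \<open>s \<le> 1\<close> of the ellipticity condition.\<close>
  define \<epsilon> where "\<epsilon> = min (\<delta> / 2) (1 / (2 * \<alpha> * (1 + C3)))"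
  have C30: "C3 > 0" using C3[OF x0D] Qpos[OF x0D] by linarith
  have \<epsilon>: "\<epsilon> > 0" "\<epsilon> < \<delta>" "2 * \<alpha> * \<epsilon> \<le> 1 / (1 + C3)"
  proof -
    show "\<epsilon> > 0" using \<delta> \<alpha> C30 by (simp add: \<epsilon>_def)
    show "\<epsilon> < \<delta>" using \<delta> by (simp add: \<epsilon>_def min_less_iff_disj)
    have "2 * \<alpha> * \<epsilon> \<le> 2 * \<alpha> * (1 / (2 * \<alpha> * (1 + C3)))"
      using \<alpha> by (intro mult_left_mono) (auto simp: \<epsilon>_def)
    then show "2 * \<alpha> * \<epsilon> \<le> 1 / (1 + C3)" using \<alpha> by simp
  qed
  define e where "e = (\<lambda>x. exp (- \<alpha> * (norm (x - y))\<^sup>2))"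
  define f where "f = (\<lambda>x. v x + \<epsilon> * e x)"
  have "continuous_on D f"
    unfolding f_def e_def by (intro continuous_intros continuous_on_subset[OF vc DS])
  then obtain z where z: "z \<in> D" "\<And>x. x \<in> D \<Longrightarrow> f x \<le> f z"
    using continuous_attains_sup[OF cD, of f] x0D by blast
  have "f z \<ge> M + \<epsilon> * exp (- \<alpha> * R\<^sup>2)"
    using z(2)[OF x0D] x0 by (simp add: f_def e_def dist_norm norm_minus_commute)
  moreover have "f z < M + \<epsilon> * exp (- \<alpha> * R\<^sup>2)" if "z \<in> sphere x0 r"
  proof (cases "z \<in> cball y R")
    case True
    then have "v z \<le> M - \<delta>" using that by (intro \<delta>) (simp add: K1_def)
    moreover have "\<epsilon> * e z \<le> \<epsilon> * 1"
      using \<epsilon> \<alpha> by (intro mult_left_mono) (auto simp: e_def)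
    ultimately show ?thesis
      using \<epsilon> unfolding f_def by (smt (verit) exp_gt_zero mult_pos_pos)
  next
    case False
    then have "R < norm (z - y)" by (simp add: dist_norm norm_minus_commute)
    then have "R\<^sup>2 < (norm (z - y))\<^sup>2" using \<open>R > 0\<close> by (intro power_strict_mono) auto
    then have "e z < exp (- \<alpha> * R\<^sup>2)" using \<alpha> by (simp add: e_def)
    then have "\<epsilon> * e z < \<epsilon> * exp (- \<alpha> * R\<^sup>2)" using \<epsilon> by simp
    moreover have "v z \<le> M" using le z(1) DS by blast
    ultimately show ?thesis by (simp add: f_def)
  qed
  ultimately have zb: "z \<in> ball x0 r"
    using z(1) by (force simp: D_def)
  then obtain r1 where r1: "r1 > 0" "ball z r1 \<subseteq> ball x0 r"
    using open_contains_ball[of "ball x0 r"] open_ball by metis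
  have r1D: "ball z r1 \<subseteq> D" using r1 by (auto simp: D_def)
  define \<tau> where "\<tau> = 2 * \<alpha> * \<epsilon> * exp (- \<alpha> * (norm (z - y))\<^sup>2)"
  have zS: "z \<in> S" using z(1) DS by blast
  have crit: "(\<chi> i. partial_deriv i v z) = \<tau> *\<^sub>R (z - y)"
    "w \<bullet> (second_partials v z *v w) \<le> \<tau> * (w \<bullet> w - 2 * \<alpha> * ((z - y) \<bullet> w)\<^sup>2)" for w
    unfolding \<tau>_def
    by (rule critical_point_of_barrier_sum[OF r1(1) vd v[OF zS]];
        use r1D DS z(2) in \<open>auto simp: f_def e_def\<close>)+
  have \<tau>: "\<tau> > 0" using \<alpha> \<epsilon> by (simp add: \<tau>_def)
  have "\<tau> \<le> 2 * \<alpha> * \<epsilon> * 1"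
    unfolding \<tau>_def using \<alpha> \<epsilon> by (intro mult_left_mono) auto
  then have "\<tau> \<le> 1 / (1 + C3)" using \<epsilon> by linarith
  then have "\<tau> * (1 + C3) \<le> 1" using C30 by (simp add: field_simps)
  moreover have "\<tau> * 1 \<le> \<tau> * (1 + C3)" "\<tau> * Q z \<le> \<tau> * (1 + C3)"
    using \<tau> C30 C3[OF z(1)] by (intro mult_left_mono; simp)+
  ultimately have "\<tau> \<le> 1" "\<tau> * Q z \<le> 1" by linarith+
  then have "\<tau> * (\<tau> * Q z) \<le> 1"
    using mult_le_one[of \<tau> "\<tau> * Q z"] \<tau> Qpos[OF z(1)] by simp
  then have small: "\<tau>\<^sup>2 * Q z \<le> 1" by (simp add: power2_eq_square mult.assoc)
  have big: "K * (K + 1) * C < 2 * \<alpha> * Q z"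
    using \<alpha> m(2)[OF z(1)] by (smt (verit) mult_left_mono)
  have "divergence h (\<lambda>z. \<phi> (metric_norm_sq h z (gradient h v z)) *\<^sub>R gradient h v z) z < 0"
    by (rule divergence_neg_at_barrier_contact[where \<xi> = "z - y" and C = C,
          OF zS v \<phi> ell ne[OF z(1)] \<tau> crit])
      (use small big C1[OF z(1)] C2[OF z(1)] in \<open>auto simp: Q_def \<eta>_def E1_def E2_def C_def\<close>)
  then show False
    using sub[OF zS] by simp
qed

text \<open>If \<open>v b < M\<close> for some \<open>b\<close> near \<open>a\<close>, then the largest open ball about \<open>b\<close> on which \<open>v < M\<close> has a point \<open>x0\<close> with
  \<open>v x0 = M\<close> on its boundary.  The ball of half its radius that is internally tangent to it at \<open>x0\<close> meets the level
  set at \<open>x0\<close> only.\<close>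

lemma strong_maximum_principle_local:
  fixes \<phi> \<phi>' :: "real \<Rightarrow> real" and v :: "real^'n \<Rightarrow> real"
  assumes vd: "\<And>x. x \<in> S \<Longrightarrow> v differentiable (at x)"
    and v: "\<And>x i. x \<in> S \<Longrightarrow> partial_deriv i v differentiable (at x)"
    and \<phi>: "\<And>s. s \<ge> 0 \<Longrightarrow> (\<phi> has_real_derivative \<phi>' s) (at s within {0..})"
    and ell: "flux_elliptic \<phi> \<phi>' K"
    and sub: "\<And>x. x \<in> S \<Longrightarrow>
      divergence h (\<lambda>z. \<phi> (metric_norm_sq h z (gradient h v z)) *\<^sub>R gradient h v z) x \<ge> 0"
    and le: "\<And>x. x \<in> S \<Longrightarrow> v x \<le> M"
    and a: "a \<in> S" "v a = M"
  obtains \<rho> where "\<rho> > 0" "ball a \<rho> \<subseteq> S" "\<And>x. x \<in> ball a \<rho> \<Longrightarrow> v x = M"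
proof -
  obtain r where r: "r > 0" "cball a r \<subseteq> S"
    using open_contains_cball open_S a(1) by metis
  have vc: "continuous_on S v"
    using vd differentiable_imp_continuous_within continuous_at_imp_continuous_on by blast
  have "v b = M" if b: "b \<in> ball a (r / 2)" for b
  proof (rule ccontr)
    assume "v b \<noteq> M"
    define N where "N = {x \<in> cball a r. v x = M}"
    have "continuous_on (cball a r) v"
      using vc r(2) continuous_on_subset by blast
    then have "closed N"
      unfolding N_def by (rule continuous_closed_preimage_constant) simp
    moreover have aN: "a \<in> N" using a r by (simp add: N_def)
    ultimately obtain x0 where x0: "x0 \<in> N" "\<And>x. x \<in> N \<Longrightarrow> dist b x0 \<le> dist b x"
      using distance_attains_inf[of N b] by blast
    define R where "R = dist b x0"
    have R: "R > 0" using \<open>v b \<noteq> M\<close> x0(1) by (auto simp: R_def N_def)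
    have Rr: "R < r / 2" using x0(2)[OF aN] b by (simp add: R_def dist_commute)
    define y where "y = midpoint b x0"
    have yR: "dist y x0 = R / 2" "dist b y = R / 2"
      by (simp_all add: y_def R_def dist_midpoint)
    have x0S: "x0 \<in> S" "v x0 = M" using x0(1) r(2) by (auto simp: N_def)
    show False
    proof (rule no_interior_touching_point[where v = v and \<phi> = \<phi> and \<phi>' = \<phi>', OF vd v \<phi> ell sub le _ x0S(1) yR(1) x0S(2)])
      show "R / 2 > 0" using R by simp
      fix x assume x: "x \<in> S" "x \<in> cball y (R / 2)" "x \<noteq> x0"
      show "v x < M"
      proof (rule ccontr)
        assume "\<not> v x < M"
        then have "v x = M" using le[OF x(1)] by simp
        have bx: "dist b x \<le> R"
          using dist_triangle[of b x y] yR(2) x(2) by simp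
        have "dist a x \<le> r"
          using dist_triangle[of a x b] bx Rr b by simp
        then have "x \<in> N" using \<open>v x = M\<close> by (simp add: N_def)
        then have "dist b x = R"
          using x0(2) bx by (force simp: R_def)
        then have "dist y x = R / 2"
          using dist_triangle[of b x y] yR(2) x(2) by simp
        \<comment> \<open>Equality in the triangle inequality for \<open>b\<close>, \<open>y\<close>, \<open>x\<close> forces \<open>x = x0\<close>.\<close>
        have n: "norm (x - y) = R / 2" "norm (y - b) = R / 2" "norm ((x - y) + (y - b)) = R"
          using \<open>dist b x = R\<close> \<open>dist y x = R / 2\<close> yR(2) by (simp_all add: dist_norm norm_minus_commute)
        then have "norm (x - y) *\<^sub>R (y - b) = norm (y - b) *\<^sub>R (x - y)"
          using norm_triangle_eq[of "x - y" "y - b"] by linarith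
        then have "y - b = x - y"
          unfolding n using R by simp
        then have "x = 2 *\<^sub>R y - b"
          by (simp add: scaleR_2 algebra_simps)
        also have "\<dots> = x0"
          by (simp add: y_def midpoint_def)
        finally show False using x(3) by simp
      qed
    qed
  qed
  then show ?thesis
    using that[of "r / 2"] r by (smt (verit) ball_subset_cball subset_trans subset_cball half_gt_zero field_sum_of_halves)
qed

text \<open>At a minimum the gradient vanishes, and with it every term of the expansion except \<open>\<phi> 0\<close> times the trace of the
  second derivatives against the inverse metric.\<close>

lemma divergence_nonneg_at_local_min:
  fixes \<phi> \<phi>' :: "real \<Rightarrow> real" and v :: "real^'n \<Rightarrow> real"
  assumes vd: "\<And>x. x \<in> S \<Longrightarrow> v differentiable (at x)"
    and v: "\<And>x i. x \<in> S \<Longrightarrow> partial_deriv i v differentiable (at x)"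
    and \<phi>: "\<And>s. s \<ge> 0 \<Longrightarrow> (\<phi> has_real_derivative \<phi>' s) (at s within {0..})"
    and "\<phi> 0 \<ge> 0"
    and a: "a \<in> S" and min: "\<And>x. x \<in> S \<Longrightarrow> v a \<le> v x"
  shows "divergence h (\<lambda>z. \<phi> (metric_norm_sq h z (gradient h v z)) *\<^sub>R gradient h v z) a \<ge> 0"
proof -
  obtain r where r: "r > 0" "ball a r \<subseteq> S"
    using open_contains_ball open_S a by metis
  have along: "(\<Sum>i\<in>UNIV. w $ i * partial_deriv i v a) = 0 \<and> 0 \<le> w \<bullet> (second_partials v a *v w)" for w
  proof -
    obtain d where d: "d > 0" "\<And>t. \<bar>t\<bar> < d \<Longrightarrow> a + t *\<^sub>R w \<in> ball a r"
      using ball_contains_short_segment[OF \<open>r > 0\<close>] by metis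
    define f where "f = (\<lambda>t. v (a + t *\<^sub>R w))"
    define f' where "f' = (\<lambda>t. \<Sum>i\<in>UNIV. w $ i * partial_deriv i v (a + t *\<^sub>R w))"
    have f: "(f has_real_derivative f' t) (at t)" if "\<bar>t\<bar> < d" for t
      unfolding f_def f'_def using d(2)[OF that] r(2) by (intro line_derivative vd) auto
    have fmin: "f 0 \<le> f t" if "\<bar>t\<bar> < d" for t
      using d(2)[OF that] r(2) min by (auto simp: f_def)
    have "f' 0 = 0"
      using DERIV_local_min[OF f[of 0] d(1)] fmin d(1) by simp
    moreover have "(f' has_real_derivative w \<bullet> (second_partials v a *v w)) (at 0)"
      unfolding f'_def by (intro line_second_derivative v a)
    ultimately show ?thesis
      using local_min_second_derivative_nonneg[OF d(1) f _ fmin] by (simp add: f'_def)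
  qed
  have "partial_deriv k v a = 0" for k
    using along[of "axis k 1"] by (simp add: axis_def if_distrib[of "\<lambda>c. c * _"] cong: if_cong)
  then have p: "(\<chi> i. partial_deriv i v a) = 0"
    by (simp add: vec_eq_iff)
  then have G: "gradient h v a = 0"
    by (simp add: gradient_def)
  have q: "metric_norm_sq h a (gradient h v a) = 0"
    by (simp add: G metric_norm_sq_def)
  have drift: "energy_drift h a 0 0 = 0" "divergence_drift h a 0 = 0"
    using energy_drift_scaleR[of h a 0 0 0] divergence_drift_scaleR[of h a 0 0] by auto
  have "x \<bullet> (matrix_inv (h a) *v x) \<ge> 0" for x
    using inv_pos[OF a, of x] by (cases "x = 0") auto
  then have "(\<Sum>i\<in>UNIV. \<Sum>j\<in>UNIV. matrix_inv (h a) $ i $ j * second_partials v a $ i $ j) \<ge> 0"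
    using along by (intro trace_mult_nonneg inv_sym a) auto
  then show ?thesis
    using divergence_expansion[where \<phi> = \<phi> and \<phi>' = \<phi>' and v = v, OF a v \<phi>] \<open>\<phi> 0 \<ge> 0\<close>
    unfolding q p unfolding G by (simp add: drift)
qed

end

section \<open>Structural assumptions and the nonlinearities\<close>

lemma deriv_half_line_eq_frechet:
  assumes "f differentiable (at t within {0..})" "t \<ge> 0"
  shows "frechet_derivative f (at t within {0..}) 1 = deriv_half_line f t"
proof -
  let ?D = "frechet_derivative f (at t within {0..})"
  have D: "(f has_derivative ?D) (at t within {0..})"
    using assms(1) frechet_derivative_works by blast
  have "?D h = h *\<^sub>R ?D 1" for h
    using linear_scale[OF has_derivative_linear[OF D], of h 1] by simp
  then have "?D = (\<lambda>h. h *\<^sub>R ?D 1)"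
    by (rule ext)
  then have "(f has_vector_derivative ?D 1) (at t within {0..})"
    using D unfolding has_vector_derivative_def by metis
  moreover have "at t within {0..} \<noteq> bot"
  proof -
    have "at_right t \<le> at t within {0..}"
      using assms(2) by (intro at_le) auto
    then show ?thesis
      using trivial_limit_at_right_real[of t] bot.extremum_uniqueI by metis
  qed
  ultimately show ?thesis
    unfolding deriv_half_line_def by (simp add: vector_derivative_within)
qed

lemma deriv_half_line_has_derivative:
  assumes "C_k_on (Suc (Suc k)) \<Phi> {0..}" "s \<ge> 0"
  shows "(deriv_half_line \<Phi> has_real_derivative deriv_half_line (deriv_half_line \<Phi>) s) (at s within {0..})"
proof -
  let ?d = "\<lambda>x. frechet_derivative \<Phi> (at x within {0..}) 1"
  have "\<Phi> differentiable_on {0..}" and d: "?d differentiable_on {0..}"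
    using assms(1) by simp_all
  then have eq: "?d x = deriv_half_line \<Phi> x" if "x \<ge> 0" for x
    using that by (intro deriv_half_line_eq_frechet) (auto simp: differentiable_on_def)
  have D: "(?d has_derivative frechet_derivative ?d (at s within {0..})) (at s within {0..})"
    using d assms(2) frechet_derivative_works by (auto simp: differentiable_on_def)
  have "(deriv_half_line \<Phi> has_derivative frechet_derivative ?d (at s within {0..})) (at s within {0..})"
    by (rule has_derivative_transform[OF _ _ D]) (use assms(2) eq in auto)
  then have "deriv_half_line \<Phi> differentiable (at s within {0..})"
    by (rule differentiableI)
  then show ?thesis
    unfolding deriv_half_line_def[of "deriv_half_line \<Phi>"] has_real_derivative_iff_has_vector_derivative
    by (rule vector_derivative_works[THEN iffD1])
qed

lemma flux_ellipticI:
  assumes "c1 > 0" and bounds: "\<And>s. 0 < s \<Longrightarrow> s \<le> 1 \<Longrightarrow> \<exists>w>0. c1 * w \<le> \<phi> s \<and> \<phi> s \<le> c2 * w \<and>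
    c1 * w \<le> \<phi> s + 2 * s * \<phi>' s \<and> \<phi> s + 2 * s * \<phi>' s \<le> c2 * w"
  shows "flux_elliptic \<phi> \<phi>' (c2 / c1)"
proof -
  have "c1 \<le> c2"
  proof -
    obtain w where "w > 0" "c1 * w \<le> c2 * w"
      using bounds[of 1] by fastforce
    then show ?thesis by simp
  qed
  moreover have "\<phi> s > 0 \<and> \<phi> s \<le> c2 / c1 * (\<phi> s + 2 * s * \<phi>' s) \<and> \<phi> s + 2 * s * \<phi>' s \<le> c2 / c1 * \<phi> s"
    if s: "0 < s" "s \<le> 1" for s
  proof -
    obtain w where w: "w > 0" "c1 * w \<le> \<phi> s" "\<phi> s \<le> c2 * w"
      "c1 * w \<le> \<phi> s + 2 * s * \<phi>' s" "\<phi> s + 2 * s * \<phi>' s \<le> c2 * w"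
      using bounds[OF s] by blast
    have K: "c2 * w \<le> c2 / c1 * t" if "c1 * w \<le> t" for t
      using mult_left_mono[OF that, of "c2 / c1"] \<open>c1 > 0\<close> \<open>c1 \<le> c2\<close> by simp
    show ?thesis
      using K[OF w(2)] K[OF w(4)] w mult_pos_pos[OF \<open>c1 > 0\<close> w(1)] by linarith
  qed
  ultimately show ?thesis
    unfolding flux_elliptic_def using \<open>c1 > 0\<close> by simp
qed

text \<open>Testing the quadratic form with \<open>\<xi> = \<sigma>\<close> extracts the radial eigenvalue.\<close>

lemma a_coeff_radial:
  fixes \<sigma> :: "real^'n"
  shows "(\<Sum>i\<in>UNIV. \<Sum>j\<in>UNIV. a_coeff \<Phi> \<sigma> i j * \<sigma> $ i * \<sigma> $ j)
    = (norm \<sigma>)\<^sup>2 * (deriv_half_line \<Phi> ((norm \<sigma>)\<^sup>2)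
        + 2 * (norm \<sigma>)\<^sup>2 * deriv_half_line (deriv_half_line \<Phi>) ((norm \<sigma>)\<^sup>2))"
proof -
  define P where "P = deriv_half_line \<Phi> ((norm \<sigma>)\<^sup>2)"
  define P' where "P' = deriv_half_line (deriv_half_line \<Phi>) ((norm \<sigma>)\<^sup>2)"
  have n: "(norm \<sigma>)\<^sup>2 = (\<Sum>i\<in>UNIV. \<sigma> $ i * \<sigma> $ i)"
    by (simp add: power2_norm_eq_inner inner_vec_def)
  have "a_coeff \<Phi> \<sigma> i j * \<sigma> $ i * \<sigma> $ j
      = 2 * P' * ((\<sigma> $ i * \<sigma> $ i) * (\<sigma> $ j * \<sigma> $ j)) + (if i = j then P * (\<sigma> $ i * \<sigma> $ i) else 0)" for i j
    by (simp add: a_coeff_def P_def[symmetric] P'_def[symmetric] algebra_simps)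
  then have "(\<Sum>i\<in>UNIV. \<Sum>j\<in>UNIV. a_coeff \<Phi> \<sigma> i j * \<sigma> $ i * \<sigma> $ j)
      = (\<Sum>i\<in>UNIV. \<Sum>j\<in>UNIV. 2 * P' * ((\<sigma> $ i * \<sigma> $ i) * (\<sigma> $ j * \<sigma> $ j)))
        + (\<Sum>i\<in>UNIV. P * (\<sigma> $ i * \<sigma> $ i))"
    by (simp add: sum.distrib)
  also have "(\<Sum>i\<in>UNIV. \<Sum>j\<in>UNIV. 2 * P' * ((\<sigma> $ i * \<sigma> $ i) * (\<sigma> $ j * \<sigma> $ j)))
      = 2 * P' * ((norm \<sigma>)\<^sup>2 * (norm \<sigma>)\<^sup>2)"
    unfolding n sum_product by (simp add: sum_distrib_left)
  also have "(\<Sum>i\<in>UNIV. P * (\<sigma> $ i * \<sigma> $ i)) = P * (norm \<sigma>)\<^sup>2"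
    unfolding n by (simp add: sum_distrib_left)
  finally show ?thesis
    unfolding P_def P'_def by (simp add: algebra_simps)
qed

lemma vector_of_norm_sqrt:
  assumes "s > 0"
  obtains \<sigma> :: "real^'n" where "\<sigma> \<noteq> 0" "(norm \<sigma>)\<^sup>2 = s"
proof -
  have "norm (axis undefined (sqrt s) :: real^'n) = sqrt s"
    using assms by (simp add: norm_eq_sqrt_inner inner_axis_axis)
  then show ?thesis
    using that[of "axis undefined (sqrt s)"] assms by (auto simp: axis_eq_0_iff)
qed

lemma assumption_A_imp_flux_elliptic:
  assumes "assumption_A TYPE('n::finite) \<Phi>"
  shows "\<exists>K. flux_elliptic (deriv_half_line \<Phi>) (deriv_half_line (deriv_half_line \<Phi>)) K"
proof -
  obtain p a c1 c2 :: real where "a \<ge> 0" "c1 > 0" and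
    b: "\<And>\<sigma> \<xi> :: real^'n. \<sigma> \<noteq> 0 \<Longrightarrow> \<xi> \<noteq> 0 \<Longrightarrow>
          c1 * (a + norm \<sigma>) powr (p - 2) \<le> deriv_half_line \<Phi> ((norm \<sigma>)\<^sup>2) \<and>
          deriv_half_line \<Phi> ((norm \<sigma>)\<^sup>2) \<le> c2 * (a + norm \<sigma>) powr (p - 2) \<and>
          c1 * (a + norm \<sigma>) powr (p - 2) * (norm \<xi>)\<^sup>2
            \<le> (\<Sum>i\<in>UNIV. \<Sum>j\<in>UNIV. a_coeff \<Phi> \<sigma> i j * \<xi> $ i * \<xi> $ j) \<and>
          (\<Sum>i\<in>UNIV. \<Sum>j\<in>UNIV. a_coeff \<Phi> \<sigma> i j * \<xi> $ i * \<xi> $ j)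
            \<le> c2 * (a + norm \<sigma>) powr (p - 2) * (norm \<xi>)\<^sup>2"
    using assms unfolding assumption_A_def
    by (elim exE conjE) (rule that, assumption, assumption, blast)
  have "flux_elliptic (deriv_half_line \<Phi>) (deriv_half_line (deriv_half_line \<Phi>)) (c2 / c1)"
  proof (rule flux_ellipticI[OF \<open>c1 > 0\<close>])
    fix s :: real assume s: "0 < s" "s \<le> 1"
    obtain \<sigma> :: "real^'n" where \<sigma>: "\<sigma> \<noteq> 0" "(norm \<sigma>)\<^sup>2 = s"
      using vector_of_norm_sqrt[OF s(1)] by blast
    define w where "w = (a + norm \<sigma>) powr (p - 2)"
    have "a + norm \<sigma> > 0" using \<sigma>(1) \<open>a \<ge> 0\<close> by (simp add: add_nonneg_pos)
    then have "w > 0" by (simp add: w_def)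
    have "c1 * w \<le> deriv_half_line \<Phi> s" "deriv_half_line \<Phi> s \<le> c2 * w"
      and "s * (c1 * w) \<le> s * (deriv_half_line \<Phi> s + 2 * s * deriv_half_line (deriv_half_line \<Phi>) s)"
      and "s * (deriv_half_line \<Phi> s + 2 * s * deriv_half_line (deriv_half_line \<Phi>) s) \<le> s * (c2 * w)"
      using b[OF \<sigma>(1) \<sigma>(1)] unfolding a_coeff_radial \<sigma>(2) w_def[symmetric] by (simp_all add: mult_ac)
    then show "\<exists>w>0. c1 * w \<le> deriv_half_line \<Phi> s \<and> deriv_half_line \<Phi> s \<le> c2 * w \<and>
        c1 * w \<le> deriv_half_line \<Phi> s + 2 * s * deriv_half_line (deriv_half_line \<Phi>) s \<and>
        deriv_half_line \<Phi> s + 2 * s * deriv_half_line (deriv_half_line \<Phi>) s \<le> c2 * w"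
      using \<open>w > 0\<close> s(1) mult_le_cancel_left_pos by blast
  qed
  then show ?thesis by blast
qed

lemma assumption_B_imp_flux_elliptic:
  assumes "assumption_B TYPE('n::finite) \<Phi>"
  shows "\<exists>K. flux_elliptic (deriv_half_line \<Phi>) (deriv_half_line (deriv_half_line \<Phi>)) K"
proof -
  obtain c1 c2 :: real where "c1 > 0" "c2 > 0" and
    bounds: "\<forall>\<sigma> :: real^'n.
          c1 * inverse (1 + norm \<sigma>) \<le> deriv_half_line \<Phi> ((norm \<sigma>)\<^sup>2) \<and>
          deriv_half_line \<Phi> ((norm \<sigma>)\<^sup>2) \<le> c2 * inverse (1 + norm \<sigma>) \<and>
          (\<forall>\<xi>' :: (real^'n) \<times> real. orthogonal \<xi>' (- \<sigma>, 1) \<longrightarrow>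
              c1 * inverse (1 + norm \<sigma>) * (norm \<xi>')\<^sup>2
                \<le> (\<Sum>i\<in>UNIV. \<Sum>j\<in>UNIV. a_coeff \<Phi> \<sigma> i j * fst \<xi>' $ i * fst \<xi>' $ j) \<and>
              (\<Sum>i\<in>UNIV. \<Sum>j\<in>UNIV. a_coeff \<Phi> \<sigma> i j * fst \<xi>' $ i * fst \<xi>' $ j)
                \<le> c2 * inverse (1 + norm \<sigma>) * (norm \<xi>')\<^sup>2)"
    using assms unfolding assumption_B_def Let_def
    by (elim exE conjE) (rule that; assumption)
  have "flux_elliptic (deriv_half_line \<Phi>) (deriv_half_line (deriv_half_line \<Phi>)) (2 * c2 / c1)"
  proof (rule flux_ellipticI[OF \<open>c1 > 0\<close>])
    fix s :: real assume s: "0 < s" "s \<le> 1"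
    obtain \<sigma> :: "real^'n" where \<sigma>: "\<sigma> \<noteq> 0" "(norm \<sigma>)\<^sup>2 = s"
      using vector_of_norm_sqrt[OF s(1)] by blast
    define w where "w = inverse (1 + norm \<sigma>)"
    define X where "X = deriv_half_line \<Phi> s + 2 * s * deriv_half_line (deriv_half_line \<Phi>) s"
    have "w > 0" by (simp add: w_def add_pos_nonneg)
    \<comment> \<open>The lift of \<open>\<xi> = \<sigma>\<close> to the hyperplane orthogonal to \<open>(- \<sigma>, 1)\<close>.\<close>
    have orth: "orthogonal (\<sigma>, s) (- \<sigma>, 1)"
      by (simp add: orthogonal_def \<sigma>(2)[symmetric] power2_norm_eq_inner)
    have n: "(norm (\<sigma>, s))\<^sup>2 = s * (1 + s)"
      using s(1) by (simp add: norm_Pair \<sigma>(2)) (simp add: power2_eq_square algebra_simps)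
    have "s * (c1 * w * (1 + s)) \<le> s * X" "s * X \<le> s * (c2 * w * (1 + s))"
      using spec[OF bounds, of \<sigma>, THEN conjunct2, THEN conjunct2, rule_format, OF orth]
      unfolding fst_conv a_coeff_radial \<sigma>(2) n w_def[symmetric] X_def by (simp_all add: mult_ac)
    then have X: "c1 * w * (1 + s) \<le> X" "X \<le> c2 * w * (1 + s)"
      using s(1) by simp_all
    \<comment> \<open>The lift has squared norm \<open>s (1 + s)\<close>; for \<open>s \<le> 1\<close> the factor \<open>1 + s\<close> costs at most a factor \<open>2\<close> in the upper bound.\<close>
    have "c1 * w * 1 \<le> c1 * w * (1 + s)" "c2 * w * (1 + s) \<le> c2 * w * 2"
      using s \<open>w > 0\<close> \<open>c1 > 0\<close> \<open>c2 > 0\<close> by (intro mult_left_mono; simp)+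
    moreover have "c2 * w \<ge> 0"
      using \<open>w > 0\<close> \<open>c2 > 0\<close> by simp
    ultimately show "\<exists>w>0. c1 * w \<le> deriv_half_line \<Phi> s \<and> deriv_half_line \<Phi> s \<le> 2 * c2 * w \<and>
        c1 * w \<le> deriv_half_line \<Phi> s + 2 * s * deriv_half_line (deriv_half_line \<Phi>) s \<and>
        deriv_half_line \<Phi> s + 2 * s * deriv_half_line (deriv_half_line \<Phi>) s \<le> 2 * c2 * w"
      using spec[OF bounds, of \<sigma>, THEN conjunct1] X \<open>w > 0\<close>
        spec[OF bounds, of \<sigma>, THEN conjunct2, THEN conjunct1] unfolding \<sigma>(2) w_def[symmetric] X_def[symmetric]
      by (intro exI[of _ w]) auto
  qed
  then show ?thesis by blast
qed

lemma flux_nonneg_at_0: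
  fixes \<phi> :: "real \<Rightarrow> real"
  assumes "(\<phi> has_real_derivative d) (at 0 within {0..})" "flux_elliptic \<phi> \<phi>' K"
  shows "\<phi> 0 \<ge> 0"
proof -
  have "(\<phi> \<longlongrightarrow> \<phi> 0) (at 0 within {0..})"
    using DERIV_continuous[OF assms(1)] by (simp add: continuous_within)
  then have "(\<phi> \<longlongrightarrow> \<phi> 0) (at_right 0)"
    by (rule tendsto_within_subset) auto
  moreover have "eventually (\<lambda>s. 0 \<le> \<phi> s) (at_right 0)"
    unfolding eventually_at_right_field
    using assms(2) by (intro exI[of _ 1]) (auto simp: flux_elliptic_def less_imp_le)
  ultimately show ?thesis
    using tendsto_lowerbound by (metis trivial_limit_at_right_real)
qed

lemma deriv_mono_of_second_deriv_nonneg: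
  fixes F :: "real \<Rightarrow> real"
  assumes "C_k_on 2 F UNIV" "\<And>t. deriv (deriv F) t \<ge> 0" "s \<le> t"
  shows "deriv F s \<le> deriv F t"
proof -
  have "F differentiable_on UNIV" and d: "(\<lambda>x. frechet_derivative F (at x) 1) differentiable_on UNIV"
    using assms(1) by (simp_all add: numeral_2_eq_2)
  have "frechet_derivative F (at x) 1 = deriv F x" for x
  proof -
    have "(F has_derivative (*) (deriv F x)) (at x)"
      using \<open>F differentiable_on UNIV\<close> DERIV_deriv_iff_real_differentiable[of F x]
      by (simp add: differentiable_on_def has_field_derivative_def)
    from frechet_derivative_at[OF this, symmetric] show ?thesis by simp
  qed
  then have "deriv F differentiable_on UNIV"
    using d by simp
  then have "(deriv F has_real_derivative deriv (deriv F) x) (at x)" for x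
    using DERIV_deriv_iff_real_differentiable[of "deriv F" x] by (simp add: differentiable_on_def)
  then show ?thesis
    using DERIV_nonneg_imp_nondecreasing[OF assms(3), of "deriv F"] assms(2) by blast
qed

section \<open>From charts to the manifold\<close>

context
  fixes X :: "'a topology" and A :: "('a, 'n::finite) chart set"
  assumes M: "smooth_manifold X A"
begin

lemma chart_inj_on: "c \<in> A \<Longrightarrow> inj_on (snd c) (fst c)"
  using M homeomorphic_imp_injective_map[of "subtopology X (fst c)" _ "snd c"]
    openin_subset[of X "fst c"]
  unfolding smooth_manifold_def is_chart_def by (auto simp: Int_absorb1)

lemma open_chart_image: "c \<in> A \<Longrightarrow> open (chart_image c)"
  using M unfolding smooth_manifold_def is_chart_def by blast

lemma topspace_eq_chart_domains: "topspace X = (\<Union>c\<in>A. fst c)"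
  using M unfolding smooth_manifold_def by (elim conjE) (rule sym)

lemma chart_domain_subset: "c \<in> A \<Longrightarrow> fst c \<subseteq> topspace X"
  using topspace_eq_chart_domains by blast

lemma chart_inv_chart: "c \<in> A \<Longrightarrow> x \<in> fst c \<Longrightarrow> chart_inv c (snd c x) = x"
  using chart_inj_on unfolding chart_inv_def by simp

lemma chart_inv_in: "y \<in> chart_image c \<Longrightarrow> chart_inv c y \<in> fst c"
  unfolding chart_image_def chart_inv_def by (rule inv_into_into)

lemma openin_chart_preimage:
  assumes "c \<in> A" "open T"
  shows "openin X {x \<in> fst c. snd c x \<in> T}"
proof -
  have "is_chart X c"
    using M assms(1) unfolding smooth_manifold_def by blast
  then have c: "openin X (fst c)"
    "continuous_map (subtopology X (fst c)) (top_of_set (chart_image c)) (snd c)"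
    unfolding is_chart_def by (blast, metis homeomorphic_imp_continuous_map)
  have "openin (top_of_set (chart_image c)) (chart_image c \<inter> T)"
    using assms(2) by (simp add: openin_open_Int)
  from openin_continuous_map_preimage[OF c(2) this]
  have "openin (subtopology X (fst c)) {x \<in> topspace (subtopology X (fst c)). snd c x \<in> chart_image c \<inter> T}" .
  moreover have "{x \<in> topspace (subtopology X (fst c)). snd c x \<in> chart_image c \<inter> T} = {x \<in> fst c. snd c x \<in> T}"
    using chart_domain_subset[OF assms(1)] by (auto simp: chart_image_def)
  ultimately show ?thesis
    using c(1) openin_trans_full by metis
qed

lemma openin_locally_in_charts:
  assumes sub: "U \<subseteq> topspace X"
    and loc: "\<And>c x. c \<in> A \<Longrightarrow> x \<in> fst c \<Longrightarrow> x \<in> U \<Longrightarrow>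
      \<exists>T. open T \<and> snd c x \<in> T \<and> T \<subseteq> chart_image c \<and> (\<forall>y\<in>T. chart_inv c y \<in> U)"
  shows "openin X U"
proof (subst openin_subopen, intro ballI)
  fix x assume "x \<in> U"
  then obtain c where c: "c \<in> A" "x \<in> fst c"
    using sub topspace_eq_chart_domains by blast
  then obtain T where T: "open T" "snd c x \<in> T" "\<And>y. y \<in> T \<Longrightarrow> chart_inv c y \<in> U"
    using loc[OF c \<open>x \<in> U\<close>] by blast
  have "z \<in> U" if "z \<in> fst c" "snd c z \<in> T" for z
    using T(3)[OF that(2)] chart_inv_chart[OF c(1) that(1)] by simp
  then show "\<exists>T. openin X T \<and> x \<in> T \<and> T \<subseteq> U"
    using openin_chart_preimage[OF c(1) T(1)] c T(2)
    by (intro exI[of _ "{x \<in> fst c. snd c x \<in> T}"]) blast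
qed

lemma C_k_function_imp_continuous_map:
  assumes "C_k_function (Suc k) A u"
  shows "continuous_map X euclideanreal u"
proof -
  have "openin X {x \<in> topspace X. u x \<in> W}" if "open W" for W
  proof (rule openin_locally_in_charts)
    fix c x assume c: "c \<in> A" "x \<in> fst c" "x \<in> {x \<in> topspace X. u x \<in> W}"
    let ?T = "{y \<in> chart_image c. (u \<circ> chart_inv c) y \<in> W}"
    have "(u \<circ> chart_inv c) differentiable (at y)" if "y \<in> chart_image c" for y
      using C_k_on_imp_differentiable[OF open_chart_image[OF c(1)] _ that] assms c(1)
      unfolding C_k_function_def by blast
    then have "continuous_on (chart_image c) (u \<circ> chart_inv c)"
      using differentiable_imp_continuous_within continuous_at_imp_continuous_on by blast
    then have "open ?T"
      using continuous_open_preimage[OF _ open_chart_image[OF c(1)] \<open>open W\<close>]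
      by (simp add: vimage_def Int_def)
    then show "\<exists>T. open T \<and> snd c x \<in> T \<and> T \<subseteq> chart_image c \<and>
        (\<forall>y\<in>T. chart_inv c y \<in> {x \<in> topspace X. u x \<in> W})"
      using c chart_domain_subset[OF c(1)]
      by (intro exI[of _ ?T]) (auto simp: chart_image_def chart_inv_chart)
  qed auto
  then show ?thesis
    by (simp add: continuous_map_def)
qed

lemma riemannian_metric_imp_local_metric:
  assumes "riemannian_metric A g" "c \<in> A"
  shows "local_metric (chart_image c) (g c)"
proof -
  have C1: "C_k_on (Suc 0) (g c) (chart_image c)"
    and "\<And>y. y \<in> chart_image c \<Longrightarrow> transpose (g c y) = g c y"
    and "\<And>y v. y \<in> chart_image c \<Longrightarrow> v \<noteq> 0 \<Longrightarrow> v \<bullet> (g c y *v v) > 0"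
    using assms unfolding riemannian_metric_def smooth_on_def by blast+
  moreover note O = open_chart_image[OF assms(2)]
  ultimately show ?thesis
    using C_k_on_imp_differentiable[OF O C1] C_k_on_imp_continuous_partial_deriv[OF O C1]
    by unfold_locales auto
qed

end

theorem theorem1p2:
  fixes X :: "'a topology"
    and A :: "('a, 'n::finite) chart set"
    and g :: "('a, 'n) chart \<Rightarrow> 'n metric_comps"
    and \<Phi> F :: "real \<Rightarrow> real"
    and u :: "'a \<Rightarrow> real"
  assumes "CARD('n) \<ge> 2"
    and "smooth_manifold X A"
    and "compact_space X"
    and "connected_space X"
    and "riemannian_metric A g"
    and "nonneg_ricci A g"
    and "C_k_on 3 \<Phi> {0..}"
    and "\<Phi> 0 = 0"
    and "C_k_on 2 F UNIV"
    and "\<And>t. F t \<ge> 0"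
    and "\<And>t. deriv (deriv F) t \<ge> 0"
    and "assumption_A TYPE('n) \<Phi> \<or> assumption_B TYPE('n) \<Phi>"
    and "C_k_function 3 A u"
    and "solves_on_manifold A g \<Phi> F u"
  shows "\<exists>k. \<forall>x\<in>topspace X. u x = k"
proof (cases "topspace X = {}")
  case True
  then show ?thesis by simp
next
  case False
  note M = assms(2)
  let ?\<phi> = "deriv_half_line \<Phi>"
  have "C_k_on (Suc (Suc (Suc 0))) \<Phi> {0..}"
    using assms(7) by (simp add: numeral_3_eq_3)
  then have \<phi>: "(?\<phi> has_real_derivative deriv_half_line ?\<phi> s) (at s within {0..})" if "s \<ge> 0" for s
    using deriv_half_line_has_derivative that by blast
  obtain K where ell: "flux_elliptic ?\<phi> (deriv_half_line ?\<phi>) K"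
    using assms(12) assumption_A_imp_flux_elliptic assumption_B_imp_flux_elliptic by blast
  have \<phi>0: "?\<phi> 0 \<ge> 0"
    using flux_nonneg_at_0[OF \<phi>[of 0] ell] by simp
  have "continuous_map X euclideanreal u"
    using C_k_function_imp_continuous_map[OF M, of 2 u] assms(13) by (simp add: eval_nat_numeral)
  then have cu: "compact (u ` topspace X)"
    using image_compactin[of X "topspace X" euclideanreal u] assms(3)
    by (simp add: compact_space_def)
  obtain a where a: "a \<in> topspace X" "\<And>x. x \<in> topspace X \<Longrightarrow> u a \<le> u x"
    using compact_attains_inf[OF cu] False by auto
  obtain b where b: "b \<in> topspace X" "\<And>x. x \<in> topspace X \<Longrightarrow> u x \<le> u b"
    using compact_attains_sup[OF cu] False by auto
  have in_top: "chart_inv c y \<in> topspace X" if "c \<in> A" "y \<in> chart_image c" for c y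
    using chart_inv_in[OF M that(2)] chart_domain_subset[OF M that(1)] by blast
  have reg: "(u \<circ> chart_inv c) differentiable (at y)" "partial_deriv i (u \<circ> chart_inv c) differentiable (at y)"
    if "c \<in> A" "y \<in> chart_image c" for c y i
  proof -
    have "C_k_on (Suc (Suc (Suc 0))) (u \<circ> chart_inv c) (chart_image c)"
      using assms(13) that(1) by (simp add: C_k_function_def numeral_3_eq_3)
    then show "(u \<circ> chart_inv c) differentiable (at y)" "partial_deriv i (u \<circ> chart_inv c) differentiable (at y)"
      using C_k_on_imp_differentiable C_k_on_imp_differentiable_partial_deriv
        open_chart_image[OF M that(1)] that(2) by blast+
  qed
  have eq: "divergence (g c) (\<lambda>z. ?\<phi> (metric_norm_sq (g c) z (gradient (g c) (u \<circ> chart_inv c) z))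
      *\<^sub>R gradient (g c) (u \<circ> chart_inv c) z) y = deriv F ((u \<circ> chart_inv c) y)"
    if "c \<in> A" "y \<in> chart_image c" for c y
    using assms(14) that unfolding solves_on_manifold_def Let_def by blast
  note local = riemannian_metric_imp_local_metric[OF M assms(5)]
  \<comment> \<open>The minimum of \<open>u\<close> fixes the sign of \<open>F'\<close> there, and convexity of \<open>F\<close> spreads it to all larger values.\<close>
  have "deriv F (u a) \<ge> 0"
  proof -
    obtain c where c: "c \<in> A" "a \<in> fst c"
      using a(1) topspace_eq_chart_domains[OF M] by blast
    have y: "snd c a \<in> chart_image c" "(u \<circ> chart_inv c) (snd c a) = u a"
      using c chart_inv_chart[OF M c] by (auto simp: chart_image_def)
    show ?thesis
      using local_metric.divergence_nonneg_at_local_min[where v = "u \<circ> chart_inv c" and \<phi> = ?\<phi>,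
          OF local[OF c(1)] reg[OF c(1)] \<phi> \<phi>0 y(1)] a(2) in_top[OF c(1)] y
      unfolding eq[OF c(1) y(1)] by simp
  qed
  then have F': "deriv F (u x) \<ge> 0" if "x \<in> topspace X" for x
    using deriv_mono_of_second_deriv_nonneg[OF assms(9,11) a(2)[OF that]] by linarith
  let ?U = "{x \<in> topspace X. u x \<in> {u b}}"
  have "openin X ?U"
  proof (rule openin_locally_in_charts[OF M])
    fix c x assume c: "c \<in> A" "x \<in> fst c" and x: "x \<in> ?U"
    have y: "snd c x \<in> chart_image c" "(u \<circ> chart_inv c) (snd c x) = u b"
      using c chart_inv_chart[OF M c] x by (auto simp: chart_image_def)
    obtain \<rho> where "\<rho> > 0" "ball (snd c x) \<rho> \<subseteq> chart_image c"
      "\<And>y. y \<in> ball (snd c x) \<rho> \<Longrightarrow> (u \<circ> chart_inv c) y = u b"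
      by (rule local_metric.strong_maximum_principle_local[where v = "u \<circ> chart_inv c" and \<phi> = ?\<phi> and M = "u b",
          OF local[OF c(1)] reg[OF c(1)] \<phi> ell _ _ y])
        (use eq[OF c(1)] F' b(2) in_top[OF c(1)] in auto)
    then show "\<exists>T. open T \<and> snd c x \<in> T \<and> T \<subseteq> chart_image c \<and> (\<forall>y\<in>T. chart_inv c y \<in> ?U)"
      using in_top[OF c(1)] by (intro exI[of _ "ball (snd c x) \<rho>"]) auto
  qed auto
  moreover have "closedin X ?U"
    using closedin_continuous_map_preimage[OF \<open>continuous_map X euclideanreal u\<close>, of "{u b}"] by simp
  ultimately have "?U = topspace X"
    using assms(4) b(1) unfolding connected_space_clopen_in by blast
  then show ?thesis by blast
qed

end
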